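(* There exist two universal constants $c_\ell, c_u$ with $0 < c_\ell < c_u < \infty$ such that the following holds for all integers $n \geq d \geq 1$ and all real $\sigma, R, B > 0$. Put $\tau_n = \sqrt{\frac{\sigma^2 B}{R^2 n}}$. (a) If $p \in (0,1]$ and $\tau_n^2 \in \left[ d^{-2/p}, \frac{1}{\log(e d)} \right]$, then $$c_\ell\, R^2 \left( \tau_n^2 \log(e d \tau_n^p) \right)^{1-p/2} \leq \mathfrak{M}_{n,d}(p,\sigma,R,B) \leq c_u\, R^2 \left( \tau_n^2 \log(e d \tau_n^p) \right)^{1-p/2}.$$ (b) If $p = 0$ and $R = s \in \{1,\dots,d\}$, then $$c_\ell\, \frac{\sigma^2 B}{n}\, s \log\left( e \frac{d}{s} \right) \leq \mathfrak{M}_{n,d}(0,\sigma,s,B) \leq c_u\, \frac{\sigma^2 B}{n}\, s \log\left( e \frac{d}{s} \right).$$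
   Context: For $\theta \in \mathbb{R}^d$ and $p \in (0,1]$, $\|\theta\|_p = \left(\sum_{i=1}^d |\theta_i|^p\right)^{1/p}$, and $\|\theta\|_0$ is the number of nonzero coordinates of $\theta$. The class of design matrices is $$\mathcal{X}_{n,d}(B) = \left\{ X \in \mathbb{R}^{n\times d} : \tfrac{1}{n} X^{T} X \succeq \tfrac{1}{B} I_d \right\},$$ where $\succeq$ is the positive semidefinite order. The minimax risk is $$\mathfrak{M}_{n,d}(p,\sigma,R,B) = \inf_{\hat\theta} \ \sup_{X \in \mathcal{X}_{n,d}(B),\ \|\theta^\star\|_p \leq R} \ \mathbf{E}_{y \sim \mathsf{N}(X\theta^\star, \sigma^2 I_n)} \left[ \|\hat\theta - \theta^\star\|_2^2 \right],$$ where the supremum is over $X\in\mathcal{X}_{n,d}(B)$ and $\theta^\star \in \mathbb{R}^d$ with $\|\theta^\star\|_p\le R$, and the infimum is over all estimators $\hat\theta = \hat\theta(X,y) \in \mathbb{R}^d$ that are measurable in the observation $y$ (and may depend on $X$ and on the problem parameters). "Universal" means not depending on $p, n, d, \sigma, s, R, B$. Here $e$ is the base of the natural logarithm $\log$. *)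

theory Defs
  imports "HOL-Probability.Probability" "Jordan_Normal_Form.Matrix"
begin

unbundle no vec_syntax
hide_const (open) Finite_Cartesian_Product.vec Finite_Cartesian_Product.mat
hide_type (open) Finite_Cartesian_Product.vec

text \<open>Dimensions vary inside the statement, so vectors and matrices are the carrier-based
  ones with explicit dimensions.\<close>

definition psd_mat :: "nat \<Rightarrow> real mat \<Rightarrow> bool" where
  "psd_mat d A \<longleftrightarrow> A \<in> carrier_mat d d \<and> transpose_mat A = A \<and>
     (\<forall>v \<in> carrier_vec d. 0 \<le> scalar_prod v (A *\<^sub>v v))"

definition designs :: "nat \<Rightarrow> nat \<Rightarrow> real \<Rightarrow> real mat set" where
  "designs n d B = {X \<in> carrier_mat n d.
     psd_mat d ((1 / real n) \<cdot>\<^sub>m (transpose_mat X * X) - (1 / B) \<cdot>\<^sub>m 1\<^sub>m d)}"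

text \<open>The case \<open>p = 0\<close> counts nonzero coordinates. For \<open>p > 0\<close> a zero coordinate contributes
  nothing, since \<open>0 powr p = 0\<close>.\<close>

definition lp_norm :: "real \<Rightarrow> real vec \<Rightarrow> real" where
  "lp_norm p v = (if p = 0 then real (card {i. i < dim_vec v \<and> v $ i \<noteq> 0})
     else (\<Sum>i<dim_vec v. \<bar>v $ i\<bar> powr p) powr (1 / p))"

definition lp_ball :: "nat \<Rightarrow> real \<Rightarrow> real \<Rightarrow> real vec set" where
  "lp_ball d p R = {v \<in> carrier_vec d. lp_norm p v \<le> R}"

definition sq_l2_norm :: "real vec \<Rightarrow> real" where
  "sq_l2_norm v = (\<Sum>i<dim_vec v. (v $ i)\<^sup>2)"

text \<open>The product Borel sigma-algebra on \<open>carrier_vec n\<close>, transported along the identification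
  of a vector with its tuple of coordinates.\<close>

definition borel_vec :: "nat \<Rightarrow> real vec measure" where
  "borel_vec n = vimage_algebra (carrier_vec n) (\<lambda>v. \<lambda>i\<in>{..<n}. v $ i)
     (\<Pi>\<^sub>M i\<in>{..<n}. borel)"

text \<open>The normal law with mean \<open>\<mu>\<close> and covariance \<open>\<sigma>\<^sup>2\<close> times the identity, as the product of
  its independent coordinates; the second argument \<open>\<sigma>\<close> is the standard deviation, as in
  \<^const>\<open>normal_density\<close>.\<close>

definition normal_vec :: "real vec \<Rightarrow> real \<Rightarrow> real vec measure" where
  "normal_vec \<mu> \<sigma> = distr (\<Pi>\<^sub>M i\<in>{..<dim_vec \<mu>}. density lborel (normal_density (\<mu> $ i) \<sigma>))
     (borel_vec (dim_vec \<mu>)) (vec (dim_vec \<mu>))"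

lemma space_borel_vec [simp]: "space (borel_vec n) = carrier_vec n"
  by (simp add: borel_vec_def)

lemma measurable_vec: "vec n \<in> (\<Pi>\<^sub>M i\<in>{..<n}. borel) \<rightarrow>\<^sub>M borel_vec n"
  unfolding borel_vec_def
proof (rule measurable_vimage_algebra2)
  have "(\<lambda>y. \<lambda>i\<in>{..<n}. y i) \<in> (\<Pi>\<^sub>M i\<in>{..<n}. borel) \<rightarrow>\<^sub>M (\<Pi>\<^sub>M i\<in>{..<n}. (borel :: real measure))"
    by measurable
  moreover have "(\<lambda>y. \<lambda>i\<in>{..<n}. vec n y $ i) = (\<lambda>y. \<lambda>i\<in>{..<n}. (y i :: real))"
    by (auto simp: fun_eq_iff)
  ultimately show "(\<lambda>y. \<lambda>i\<in>{..<n}. vec n y $ i) \<in> (\<Pi>\<^sub>M i\<in>{..<n}. borel) \<rightarrow>\<^sub>M (\<Pi>\<^sub>M i\<in>{..<n}. (borel :: real measure))"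
    by simp
qed auto

lemma prob_space_normal_vec:
  assumes "\<sigma> > 0"
  shows "prob_space (normal_vec \<mu> \<sigma>)"
proof -
  have "prob_space (\<Pi>\<^sub>M i\<in>{..<dim_vec \<mu>}. density lborel (normal_density (\<mu> $ i) \<sigma>))"
    by (rule prob_space_PiM) (rule prob_space_normal_density[OF assms])
  moreover have "sets (\<Pi>\<^sub>M i\<in>{..<dim_vec \<mu>}. density lborel (normal_density (\<mu> $ i) \<sigma>)) =
      sets (\<Pi>\<^sub>M i\<in>{..<dim_vec \<mu>}. borel)"
    by (rule sets_PiM_cong) simp_all
  then have "vec (dim_vec \<mu>) \<in> (\<Pi>\<^sub>M i\<in>{..<dim_vec \<mu>}. density lborel (normal_density (\<mu> $ i) \<sigma>))
      \<rightarrow>\<^sub>M borel_vec (dim_vec \<mu>)"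
    using measurable_vec measurable_cong_sets by blast
  ultimately show ?thesis
    unfolding normal_vec_def by (rule prob_space.prob_space_distr)
qed

definition estimators :: "nat \<Rightarrow> nat \<Rightarrow> (real mat \<Rightarrow> real vec \<Rightarrow> real vec) set" where
  "estimators n d = {T. \<forall>X \<in> carrier_mat n d. T X \<in> borel_vec n \<rightarrow>\<^sub>M borel_vec d}"

text \<open>Risks are extended nonnegative reals, so that estimators of infinite risk need no
  separate treatment.\<close>

definition risk :: "(real mat \<Rightarrow> real vec \<Rightarrow> real vec) \<Rightarrow> real \<Rightarrow> real mat \<Rightarrow> real vec \<Rightarrow> ennreal" where
  "risk T \<sigma> X \<theta> = (\<integral>\<^sup>+ y. ennreal (sq_l2_norm (T X y - \<theta>)) \<partial>normal_vec (X *\<^sub>v \<theta>) \<sigma>)"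

definition minimax_risk :: "nat \<Rightarrow> nat \<Rightarrow> real \<Rightarrow> real \<Rightarrow> real \<Rightarrow> real \<Rightarrow> ennreal" where
  "minimax_risk n d p \<sigma> R B =
     (INF T \<in> estimators n d. SUP (X, \<theta>) \<in> designs n d B \<times> lp_ball d p R. risk T \<sigma> X \<theta>)"

end

theory Submission
  imports Defs "Jordan_Normal_Form.Determinant"
begin

text \<open>Write \<open>\<omega>\<^sup>2 = \<sigma>\<^sup>2 B / n\<close>. The condition defining the designs says that the least squares estimate
recovers every coordinate of \<open>\<theta>\<close> with Gaussian noise of variance at most \<open>\<omega>\<^sup>2\<close>, and the design
\<open>sqrt (n / B)\<close> times the identity (padded with zero rows) attains this for all coordinates at
once, with independent noise. So the problem is as hard as estimating a sparse vector observed
coordinate by coordinate with noise level \<open>\<omega>\<close>.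

Upper bound. Soft thresholding of the least squares estimate at level \<open>l\<close> has risk at most a constant
times \<open>\<Sum>\<^sub>i min (\<theta>\<^sub>i\<^sup>2) (l\<^sup>2) + d \<omega>\<^sup>2 exp (- l\<^sup>2 / (2 \<omega>\<^sup>2))\<close> (\<open>minimax_risk_le_threshold\<close>). The
correlations of the least squares coordinates are irrelevant since the squared loss is a sum over
coordinates. The level \<open>l\<^sup>2 = 2 \<omega>\<^sup>2 L\<close>, with \<open>L\<close> the logarithm in the claimed rate, makes both terms
at most a constant times that rate: the sum is at most \<open>s l\<^sup>2\<close> on vectors with \<open>s\<close> nonzero
coordinates and at most \<open>l\<^bsup>2-p\<^esup> R\<^sup>p\<close> on the \<open>p\<close>-ball of radius \<open>R\<close>.

Lower bound. Split the first \<open>s m\<close> coordinates, \<open>m = d div s\<close>, into \<open>s\<close> blocks of length \<open>m\<close>. Under the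
prior each block is independently zero with probability \<open>1/2\<close>, and otherwise has a single entry \<open>\<delta>\<close>
at a uniformly chosen position. For each coordinate, the hypothesis that its block is zero has \<open>m\<close>
times the weight of the hypothesis that the \<open>\<delta>\<close> sits there, and the two cannot be told apart as long
as the chi-square divergence between them is of order \<open>m\<close>, that is, as long as \<open>\<delta>\<^sup>2 / \<omega>\<^sup>2 \<le> ln (e m)\<close>
(\<open>normal_vec_two_point_bound\<close>). Summing over the coordinates, the Bayes risk is at least a constant
times \<open>s \<delta>\<^sup>2\<close> (\<open>minimax_risk_ge_blocks\<close>). For counting sparsity take \<open>\<delta>\<^sup>2\<close> of order
\<open>\<omega>\<^sup>2 ln (e d / s)\<close>; for the \<open>p\<close>-ball take \<open>\<delta>\<^sup>2\<close> of order \<open>\<omega>\<^sup>2 L\<close> and \<open>s\<close> about \<open>(R / (\<omega> sqrt L))\<^sup>p\<close>,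
which keeps \<open>s \<delta>\<^sup>p\<close> below \<open>R\<^sup>p\<close>. The two bounds on \<open>\<tau>\<close> are what makes \<open>1 \<le> s \<le> d\<close> possible.\<close>

section \<open>Gaussian observations and coordinatewise risk\<close>

abbreviation gaussian :: "real \<Rightarrow> real \<Rightarrow> real measure" where
  "gaussian \<mu> \<sigma> \<equiv> density lborel (normal_density \<mu> \<sigma>)"

lemma nn_integral_normal_density:
  "0 < \<sigma> \<Longrightarrow> (\<integral>\<^sup>+ y. ennreal (normal_density \<mu> \<sigma> y) \<partial>lborel) = 1"
  by (subst nn_integral_eq_integral) auto

lemma nn_integral_normal_vec:
  assumes "\<mu> \<in> carrier_vec n" and f: "f \<in> borel_measurable (borel_vec n)"
  shows "(\<integral>\<^sup>+ y. f y \<partial>normal_vec \<mu> \<sigma>)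
    = (\<integral>\<^sup>+ x. f (vec n x) \<partial>(\<Pi>\<^sub>M i\<in>{..<n}. gaussian (\<mu> $ i) \<sigma>))"
proof -
  have "sets (\<Pi>\<^sub>M i\<in>{..<n}. gaussian (\<mu> $ i) \<sigma>) = sets (\<Pi>\<^sub>M i\<in>{..<n}. borel)"
    by (rule sets_PiM_cong) simp_all
  then have "vec n \<in> (\<Pi>\<^sub>M i\<in>{..<n}. gaussian (\<mu> $ i) \<sigma>) \<rightarrow>\<^sub>M borel_vec n"
    using measurable_vec measurable_cong_sets by blast
  then show ?thesis
    using assms unfolding normal_vec_def by (auto simp: nn_integral_distr)
qed

lemma measurable_vec_component [measurable]:
  assumes "i < n" shows "(\<lambda>v. v $ i) \<in> borel_measurable (borel_vec n)"
proof -
  have "(\<lambda>v. \<lambda>i\<in>{..<n}. v $ i) \<in> borel_vec n \<rightarrow>\<^sub>M (\<Pi>\<^sub>M i\<in>{..<n}. (borel::real measure))"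
    unfolding borel_vec_def by (rule measurable_vimage_algebra1) (auto simp: space_PiM)
  from measurable_compose[OF this measurable_component_singleton[of i]] assms
  show ?thesis by simp
qed

lemma measurable_into_borel_vec:
  assumes "\<And>v. v \<in> space M \<Longrightarrow> f v \<in> carrier_vec d"
    and "\<And>i. i < d \<Longrightarrow> (\<lambda>v. f v $ i) \<in> borel_measurable M"
  shows "f \<in> M \<rightarrow>\<^sub>M borel_vec d"
  unfolding borel_vec_def using assms
  by (intro measurable_vimage_algebra2 measurable_restrict) auto

lemma measurable_scalar_prod [measurable]:
  assumes "a \<in> carrier_vec n"
  shows "(\<lambda>y. scalar_prod a y) \<in> borel_measurable (borel_vec n)"
proof -
  have "(\<lambda>y. \<Sum>i<n. a $ i * y $ i) \<in> borel_measurable (borel_vec n)"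
    by (intro borel_measurable_sum borel_measurable_times borel_measurable_const
        measurable_vec_component) auto
  moreover have "scalar_prod a y = (\<Sum>i<n. a $ i * y $ i)" if "y \<in> space (borel_vec n)" for y
    using that by (auto simp: scalar_prod_def atLeast0LessThan)
  ultimately show ?thesis by (subst measurable_cong)
qed

lemma product_sigma_finite_gaussian:
  "0 < \<sigma> \<Longrightarrow> product_sigma_finite (\<lambda>i. gaussian (\<mu> i) \<sigma>)"
  by (simp add: product_sigma_finite_def prob_space_normal_density prob_space_imp_sigma_finite)

lemma measurable_estimator_component:
  assumes "T \<in> estimators n d" "X \<in> carrier_mat n d" "i < d"
  shows "(\<lambda>y. T X y $ i) \<in> borel_measurable (borel_vec n)"
  using assms unfolding estimators_def
  by (auto intro!: measurable_compose[OF _ measurable_vec_component[OF \<open>i < d\<close>]])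

text \<open>The squared loss splits over coordinates, so both bounds can be proved one coordinate at a time.\<close>

lemma risk_eq_sum:
  assumes "T \<in> estimators n d" "X \<in> carrier_mat n d" "\<theta> \<in> carrier_vec d"
  shows "risk T \<sigma> X \<theta> = (\<Sum>i<d. \<integral>\<^sup>+ y. ennreal ((T X y $ i - \<theta> $ i)\<^sup>2) \<partial>normal_vec (X *\<^sub>v \<theta>) \<sigma>)"
proof -
  have M: "(\<lambda>y. ennreal ((T X y $ i - \<theta> $ i)\<^sup>2)) \<in> borel_measurable (normal_vec (X *\<^sub>v \<theta>) \<sigma>)"
    if "i < d" for i
  proof -
    have "(\<lambda>y. T X y $ i) \<in> borel_measurable (normal_vec (X *\<^sub>v \<theta>) \<sigma>)"
      using measurable_estimator_component[OF assms(1,2) that] assms(2)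
      by (simp add: normal_vec_def)
    then show ?thesis by measurable
  qed
  show ?thesis
    using assms M unfolding risk_def sq_l2_norm_def
    by (subst nn_integral_sum[symmetric]) (auto simp: sum_ennreal intro!: nn_integral_cong arg_cong[where f = ennreal] sum.cong)
qed

section \<open>Lower bound over block-sparse vectors\<close>

text \<open>The optimal estimator has value \<open>\<delta>\<^sup>2\<close> times the integral of \<open>f\<^sub>1 / (1 + f\<^sub>1 / (m f\<^sub>0))\<close>, where \<open>f\<^sub>0\<close>, \<open>f\<^sub>1\<close>
are the two densities. Since \<open>1 / u\<close> is convex, Jensen's inequality bounds that integral below by
\<open>1 / (1 + D / m)\<close>, where \<open>D\<close>, the integral of \<open>f\<^sub>1\<^sup>2 / f\<^sub>0\<close>, equals \<open>exp ((\<mu>\<^sub>1 - \<mu>\<^sub>0)\<^sup>2 / \<sigma>\<^sup>2)\<close> and is at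
most \<open>e m\<close>. Jensen is applied in the form of the tangent line \<open>1 / u \<ge> 2 c - c\<^sup>2 u\<close> at \<open>u = 1 / c\<close>,
\<open>c = 1 / (1 + e)\<close>, with the negative term moved to the other side to keep all integrands nonnegative.\<close>

lemma gaussian_two_point_bound:
  fixes T :: "real \<Rightarrow> real"
  assumes [measurable]: "T \<in> borel_measurable borel"
    and "0 < \<sigma>" "1 \<le> m" and close: "exp ((\<mu>\<^sub>1 - \<mu>\<^sub>0)\<^sup>2 / \<sigma>\<^sup>2) \<le> exp 1 * m"
  shows "ennreal (\<delta>\<^sup>2 / (1 + exp 1)) \<le>
    ennreal m * (\<integral>\<^sup>+ y. ennreal ((T y)\<^sup>2) \<partial>gaussian \<mu>\<^sub>0 \<sigma>) + (\<integral>\<^sup>+ y. ennreal ((T y - \<delta>)\<^sup>2) \<partial>gaussian \<mu>\<^sub>1 \<sigma>)"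
proof -
  define f\<^sub>0 f\<^sub>1 g where "f\<^sub>0 = normal_density \<mu>\<^sub>0 \<sigma>" and "f\<^sub>1 = normal_density \<mu>\<^sub>1 \<sigma>"
    and "g = normal_density (2 * \<mu>\<^sub>1 - \<mu>\<^sub>0) \<sigma>"
  define D where "D = exp ((\<mu>\<^sub>1 - \<mu>\<^sub>0)\<^sup>2 / \<sigma>\<^sup>2)"
  define c :: real where "c = 1 / (1 + exp 1)"
  have c: "0 < c" "c * (1 + exp 1) = 1"
    using exp_gt_zero[of "1::real"] by (auto simp: c_def simp del: exp_gt_zero)
  have f0: "0 < f\<^sub>0 y" for y using assms by (simp add: f\<^sub>0_def normal_density_pos)
  have f1: "0 < f\<^sub>1 y" for y using assms by (simp add: f\<^sub>1_def normal_density_pos)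
  have g0: "0 < g y" for y using assms by (simp add: g_def normal_density_pos)
  have [measurable]: "f\<^sub>0 \<in> borel_measurable borel" "f\<^sub>1 \<in> borel_measurable borel" "g \<in> borel_measurable borel"
    by (auto simp: f\<^sub>0_def f\<^sub>1_def g_def)
  \<comment> \<open>The quotient \<open>f\<^sub>1\<^sup>2 / f\<^sub>0\<close> is again Gaussian up to the factor \<open>D\<close>, with mean \<open>2 \<mu>\<^sub>1 - \<mu>\<^sub>0\<close>.\<close>
  have ratio: "f\<^sub>1 y * f\<^sub>1 y = D * g y * f\<^sub>0 y" for y
  proof -
    have "-(y - \<mu>\<^sub>1)\<^sup>2 / (2 * \<sigma>\<^sup>2) + -(y - \<mu>\<^sub>1)\<^sup>2 / (2 * \<sigma>\<^sup>2)
        = (\<mu>\<^sub>1 - \<mu>\<^sub>0)\<^sup>2 / \<sigma>\<^sup>2 + -(y - (2 * \<mu>\<^sub>1 - \<mu>\<^sub>0))\<^sup>2 / (2 * \<sigma>\<^sup>2) + -(y - \<mu>\<^sub>0)\<^sup>2 / (2 * \<sigma>\<^sup>2)"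
      using assms(2) by (simp add: field_simps power2_eq_square)
    then have "exp (-(y - \<mu>\<^sub>1)\<^sup>2 / (2 * \<sigma>\<^sup>2)) * exp (-(y - \<mu>\<^sub>1)\<^sup>2 / (2 * \<sigma>\<^sup>2))
        = D * exp (-(y - (2 * \<mu>\<^sub>1 - \<mu>\<^sub>0))\<^sup>2 / (2 * \<sigma>\<^sup>2)) * exp (-(y - \<mu>\<^sub>0)\<^sup>2 / (2 * \<sigma>\<^sup>2))"
      by (simp only: exp_add[symmetric] D_def)
    then show ?thesis
      by (simp add: f\<^sub>0_def f\<^sub>1_def g_def normal_density_def)
  qed
  have pointwise: "2 * c * \<delta>\<^sup>2 * f\<^sub>1 y
      \<le> m * (f\<^sub>0 y * (T y)\<^sup>2) + f\<^sub>1 y * (T y - \<delta>)\<^sup>2 + c\<^sup>2 * \<delta>\<^sup>2 * (f\<^sub>1 y + D / m * g y)" for y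
  proof -
    \<comment> \<open>\<open>r\<close> is the likelihood ratio \<open>f\<^sub>1 / (m f\<^sub>0)\<close>, written so that its relation to \<open>g\<close> is visible.\<close>
    define r x where "r = D * g y / (m * f\<^sub>1 y)" and "x = T y"
    have m: "m > 0" using assms by simp
    have r: "r > 0" using f1 g0 m by (simp add: r_def D_def)
    have rf: "m * f\<^sub>0 y * r = f\<^sub>1 y" "D / m * g y = f\<^sub>1 y * r"
      using ratio[of y] f1[of y] m by (auto simp: r_def field_simps)
    have "2 * c * \<delta>\<^sup>2 * r \<le> x\<^sup>2 + r * (x - \<delta>)\<^sup>2 + c\<^sup>2 * \<delta>\<^sup>2 * (r + r * r)"
    proof -
      \<comment> \<open>The first square vanishes at the optimal \<open>x = r \<delta> / (1 + r)\<close>, the second where the tangent touches.\<close>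
      have "(1 + r) * (x\<^sup>2 + r * (x - \<delta>)\<^sup>2 + c\<^sup>2 * \<delta>\<^sup>2 * (r + r * r) - 2 * c * \<delta>\<^sup>2 * r)
          = ((1 + r) * x - r * \<delta>)\<^sup>2 + r * \<delta>\<^sup>2 * (c * (1 + r) - 1)\<^sup>2"
        by (simp add: power2_eq_square algebra_simps)
      also have "\<dots> \<ge> 0" using r by simp
      finally show ?thesis using r by (simp add: zero_le_mult_iff)
    qed
    then have "m * f\<^sub>0 y * (2 * c * \<delta>\<^sup>2 * r)
        \<le> m * f\<^sub>0 y * (x\<^sup>2 + r * (x - \<delta>)\<^sup>2 + c\<^sup>2 * \<delta>\<^sup>2 * (r + r * r))"
      using m f0[of y] by (intro mult_left_mono) auto
    also have "\<dots> = m * f\<^sub>0 y * x\<^sup>2 + (m * f\<^sub>0 y * r) * (x - \<delta>)\<^sup>2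
        + c\<^sup>2 * \<delta>\<^sup>2 * (m * f\<^sub>0 y * r + m * f\<^sub>0 y * r * r)"
      by (simp add: algebra_simps)
    also have "m * f\<^sub>0 y * (2 * c * \<delta>\<^sup>2 * r) = 2 * c * \<delta>\<^sup>2 * (m * f\<^sub>0 y * r)" by simp
    finally show ?thesis unfolding rf x_def by (simp add: mult.assoc)
  qed
  have int1: "(\<integral>\<^sup>+ y. ennreal (f\<^sub>1 y) \<partial>lborel) = 1" "(\<integral>\<^sup>+ y. ennreal (g y) \<partial>lborel) = 1"
    using assms(2) by (auto simp: f\<^sub>1_def g_def nn_integral_normal_density)
  let ?I = "ennreal m * (\<integral>\<^sup>+ y. ennreal ((T y)\<^sup>2) \<partial>gaussian \<mu>\<^sub>0 \<sigma>) + (\<integral>\<^sup>+ y. ennreal ((T y - \<delta>)\<^sup>2) \<partial>gaussian \<mu>\<^sub>1 \<sigma>)"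
  have I: "?I = (\<integral>\<^sup>+ y. ennreal (m * (f\<^sub>0 y * (T y)\<^sup>2) + f\<^sub>1 y * (T y - \<delta>)\<^sup>2) \<partial>lborel)"
    using assms(3)
    by (simp add: nn_integral_density ennreal_mult' ennreal_plus nn_integral_add nn_integral_cmult
        f\<^sub>0_def[symmetric] f\<^sub>1_def[symmetric] f0 f1 less_imp_le)
  have G: "(\<integral>\<^sup>+ y. ennreal (c\<^sup>2 * \<delta>\<^sup>2 * (f\<^sub>1 y + D / m * g y)) \<partial>lborel) = ennreal (c\<^sup>2 * \<delta>\<^sup>2 * (1 + D / m))"
  proof -
    define E where "E = D / m"
    have "0 \<le> E" using assms(3) by (simp add: E_def D_def)
    then show ?thesis
      using c int1 unfolding E_def[symmetric]
      by (simp add: ennreal_mult' ennreal_plus nn_integral_add nn_integral_cmult f1 g0 less_imp_le)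
  qed
  have "ennreal (2 * c * \<delta>\<^sup>2) = (\<integral>\<^sup>+ y. ennreal (2 * c * \<delta>\<^sup>2 * f\<^sub>1 y) \<partial>lborel)"
    using c int1 by (simp add: ennreal_mult' nn_integral_cmult)
  also have "\<dots> \<le> (\<integral>\<^sup>+ y. ennreal (m * (f\<^sub>0 y * (T y)\<^sup>2) + f\<^sub>1 y * (T y - \<delta>)\<^sup>2)
      + ennreal (c\<^sup>2 * \<delta>\<^sup>2 * (f\<^sub>1 y + D / m * g y)) \<partial>lborel)"
  proof (rule nn_integral_mono)
    fix y
    have "0 \<le> m * (f\<^sub>0 y * (T y)\<^sup>2) + f\<^sub>1 y * (T y - \<delta>)\<^sup>2"
      "0 \<le> c\<^sup>2 * \<delta>\<^sup>2 * (f\<^sub>1 y + D / m * g y)"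
      using assms(3) f0[of y] f1[of y] g0[of y] by (auto simp: D_def)
    then show "ennreal (2 * c * \<delta>\<^sup>2 * f\<^sub>1 y) \<le> ennreal (m * (f\<^sub>0 y * (T y)\<^sup>2) + f\<^sub>1 y * (T y - \<delta>)\<^sup>2)
        + ennreal (c\<^sup>2 * \<delta>\<^sup>2 * (f\<^sub>1 y + D / m * g y))"
      using ennreal_leI[OF pointwise[of y]] by (simp only: ennreal_plus)
  qed
  also have "\<dots> = ?I + ennreal (c\<^sup>2 * \<delta>\<^sup>2 * (1 + D / m))"
    unfolding I G[symmetric] by (rule nn_integral_add) auto
  also have "\<dots> \<le> ?I + ennreal (c * \<delta>\<^sup>2)"
  proof (intro add_left_mono ennreal_leI)
    have "c\<^sup>2 * \<delta>\<^sup>2 * (1 + D / m) \<le> c\<^sup>2 * \<delta>\<^sup>2 * (1 + exp 1)"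
      using close assms(3) by (intro mult_left_mono) (auto simp: D_def field_simps)
    also have "\<dots> = c * \<delta>\<^sup>2 * (c * (1 + exp 1))" by (simp add: power2_eq_square)
    finally show "c\<^sup>2 * \<delta>\<^sup>2 * (1 + D / m) \<le> c * \<delta>\<^sup>2" using c by simp
  qed
  also have "ennreal (2 * c * \<delta>\<^sup>2) = ennreal (c * \<delta>\<^sup>2) + ennreal (c * \<delta>\<^sup>2)"
    using c by (subst ennreal_plus[symmetric]) auto
  finally have "ennreal (c * \<delta>\<^sup>2) + ennreal (c * \<delta>\<^sup>2) \<le> ?I + ennreal (c * \<delta>\<^sup>2)" .
  then have "ennreal (c * \<delta>\<^sup>2) \<le> ?I"
    by simp
  then show ?thesis by (simp add: c_def)
qed

text \<open>If the means differ in one coordinate only, the other coordinates have the same law under both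
hypotheses: conditionally on them the one-dimensional bound applies, whatever their values.\<close>

lemma normal_vec_two_point_bound:
  fixes T :: "real vec \<Rightarrow> real"
  assumes T: "T \<in> borel_measurable (borel_vec n)"
    and "0 < \<sigma>" "1 \<le> m" "i < n"
    and \<mu>\<^sub>0: "\<mu>\<^sub>0 \<in> carrier_vec n" and \<mu>\<^sub>1: "\<mu>\<^sub>1 \<in> carrier_vec n"
    and eq: "\<And>j. j < n \<Longrightarrow> j \<noteq> i \<Longrightarrow> \<mu>\<^sub>0 $ j = \<mu>\<^sub>1 $ j"
    and close: "exp ((\<mu>\<^sub>1 $ i - \<mu>\<^sub>0 $ i)\<^sup>2 / \<sigma>\<^sup>2) \<le> exp 1 * m"
  shows "ennreal (\<delta>\<^sup>2 / (1 + exp 1)) \<le>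
    ennreal m * (\<integral>\<^sup>+ y. ennreal ((T y)\<^sup>2) \<partial>normal_vec \<mu>\<^sub>0 \<sigma>)
      + (\<integral>\<^sup>+ y. ennreal ((T y - \<delta>)\<^sup>2) \<partial>normal_vec \<mu>\<^sub>1 \<sigma>)"
proof -
  define J where "J = {..<n} - {i}"
  have J: "finite J" "i \<notin> J" "{..<n} = insert i J"
    using \<open>i < n\<close> by (auto simp: J_def)
  have sets_eq: "sets (Pi\<^sub>M K (\<lambda>j. gaussian (\<mu> $ j) \<sigma>)) = sets (\<Pi>\<^sub>M j\<in>K. borel)" for \<mu> and K :: "nat set"
    by (rule sets_PiM_cong) simp_all
  have Tv: "(\<lambda>x. T (vec n x)) \<in> borel_measurable (\<Pi>\<^sub>M j\<in>insert i J. borel)"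
    using measurable_compose[OF measurable_vec T] J by simp
  define P where "P = Pi\<^sub>M J (\<lambda>j. gaussian (\<mu>\<^sub>0 $ j) \<sigma>)"
  have P1: "P = Pi\<^sub>M J (\<lambda>j. gaussian (\<mu>\<^sub>1 $ j) \<sigma>)"
    unfolding P_def by (rule PiM_cong) (auto simp: J_def eq)
  interpret P: prob_space P
    unfolding P_def using \<open>0 < \<sigma>\<close> by (intro prob_space_PiM prob_space_normal_density)
  define S where "S x y = T (vec n (x(i := y)))" for x y
  have P_sets: "sets P = sets (\<Pi>\<^sub>M j\<in>J. borel)" by (simp add: P_def sets_eq)
  have "(\<lambda>(x, y). x(i := y)) \<in> (\<Pi>\<^sub>M j\<in>J. borel) \<Otimes>\<^sub>M borel \<rightarrow>\<^sub>M (\<Pi>\<^sub>M j\<in>insert i J. (borel::real measure))"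
    using measurable_add_dim[of i J "\<lambda>_. borel"] by simp
  from measurable_compose[OF this Tv]
  have S2: "(\<lambda>(x, y). S x y) \<in> borel_measurable (P \<Otimes>\<^sub>M borel)"
    by (simp add: S_def case_prod_unfold P_sets cong: measurable_cong_sets sets_pair_measure_cong)
  note S2' [measurable] = S2[unfolded case_prod_unfold]
  have Sx: "S x \<in> borel_measurable borel" if "x \<in> space P" for x
    using measurable_Pair2[OF S2 that] by simp
  have split: "(\<integral>\<^sup>+ y. ennreal ((T y - e)\<^sup>2) \<partial>normal_vec \<mu> \<sigma>)
      = (\<integral>\<^sup>+ x. (\<integral>\<^sup>+ y. ennreal ((S x y - e)\<^sup>2) \<partial>gaussian (\<mu> $ i) \<sigma>) \<partial>P)"
    if "\<mu> \<in> carrier_vec n" "P = Pi\<^sub>M J (\<lambda>j. gaussian (\<mu> $ j) \<sigma>)" for \<mu> e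
  proof -
    interpret product_sigma_finite "\<lambda>j. gaussian (\<mu> $ j) \<sigma>"
      using \<open>0 < \<sigma>\<close> by (rule product_sigma_finite_gaussian)
    have "(\<lambda>y. ennreal ((T y - e)\<^sup>2)) \<in> borel_measurable (borel_vec n)"
      using T by measurable
    then have "(\<integral>\<^sup>+ y. ennreal ((T y - e)\<^sup>2) \<partial>normal_vec \<mu> \<sigma>)
        = (\<integral>\<^sup>+ x. ennreal ((T (vec n x) - e)\<^sup>2) \<partial>Pi\<^sub>M (insert i J) (\<lambda>j. gaussian (\<mu> $ j) \<sigma>))"
      unfolding J(3)[symmetric] by (intro nn_integral_normal_vec that(1))
    also have "\<dots> = (\<integral>\<^sup>+ x. (\<integral>\<^sup>+ y. ennreal ((T (vec n (x(i := y))) - e)\<^sup>2) \<partial>gaussian (\<mu> $ i) \<sigma>)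
        \<partial>Pi\<^sub>M J (\<lambda>j. gaussian (\<mu> $ j) \<sigma>))"
    proof (rule product_nn_integral_insert[OF J(1,2)])
      have "(\<lambda>x. ennreal ((T (vec n x) - e)\<^sup>2)) \<in> borel_measurable (\<Pi>\<^sub>M j\<in>insert i J. borel)"
        using Tv by measurable
      then show "(\<lambda>x. ennreal ((T (vec n x) - e)\<^sup>2)) \<in> borel_measurable (Pi\<^sub>M (insert i J) (\<lambda>j. gaussian (\<mu> $ j) \<sigma>))"
        by (simp add: sets_eq cong: measurable_cong_sets)
    qed
    finally show ?thesis unfolding S_def that(2) .
  qed
  have inner: "(\<lambda>x. \<integral>\<^sup>+ y. ennreal ((S x y - e)\<^sup>2) \<partial>gaussian \<mu> \<sigma>) \<in> borel_measurable P" for e \<mu>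
  proof -
    interpret sigma_finite_measure "gaussian \<mu> \<sigma>"
      using \<open>0 < \<sigma>\<close> by (simp add: prob_space_normal_density prob_space_imp_sigma_finite)
    have "(\<lambda>z. ennreal ((S (fst z) (snd z) - e)\<^sup>2)) \<in> borel_measurable (P \<Otimes>\<^sub>M borel)"
      by measurable
    then have "(\<lambda>(x, y). ennreal ((S x y - e)\<^sup>2)) \<in> borel_measurable (P \<Otimes>\<^sub>M gaussian \<mu> \<sigma>)"
      by (simp add: case_prod_unfold cong: measurable_cong_sets sets_pair_measure_cong)
    then show ?thesis by (rule borel_measurable_nn_integral)
  qed
  have "ennreal (\<delta>\<^sup>2 / (1 + exp 1)) = (\<integral>\<^sup>+ x. ennreal (\<delta>\<^sup>2 / (1 + exp 1)) \<partial>P)"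
    by (simp add: P.emeasure_space_1)
  also have "\<dots> \<le> (\<integral>\<^sup>+ x. ennreal m * (\<integral>\<^sup>+ y. ennreal ((S x y - 0)\<^sup>2) \<partial>gaussian (\<mu>\<^sub>0 $ i) \<sigma>)
      + (\<integral>\<^sup>+ y. ennreal ((S x y - \<delta>)\<^sup>2) \<partial>gaussian (\<mu>\<^sub>1 $ i) \<sigma>) \<partial>P)"
    using gaussian_two_point_bound[OF Sx \<open>0 < \<sigma>\<close> \<open>1 \<le> m\<close> close]
    by (intro nn_integral_mono) simp
  also have "\<dots> = ennreal m * (\<integral>\<^sup>+ y. ennreal ((T y - 0)\<^sup>2) \<partial>normal_vec \<mu>\<^sub>0 \<sigma>)
      + (\<integral>\<^sup>+ y. ennreal ((T y - \<delta>)\<^sup>2) \<partial>normal_vec \<mu>\<^sub>1 \<sigma>)"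
    using inner by (simp only: nn_integral_add nn_integral_cmult borel_measurable_times_ennreal
        borel_measurable_const split[OF \<mu>\<^sub>0 P_def] split[OF \<mu>\<^sub>1 P1])
  finally show ?thesis by simp
qed

text \<open>The product prior is invariant under resampling the coordinate \<open>b\<close>: \<open>(g, v) \<mapsto> (g(b := v), g b)\<close> is an
involution. This isolates one block of the prior while averaging over all the others.\<close>

lemma sum_PiE_resample:
  fixes f :: "('i \<Rightarrow> 'v) \<Rightarrow> 'c::semiring_1"
  assumes "b \<in> S"
  shows "(\<Sum>g\<in>S \<rightarrow>\<^sub>E A. \<Sum>v\<in>A. f (g(b := v))) = of_nat (card A) * (\<Sum>g\<in>S \<rightarrow>\<^sub>E A. f g)"
proof -
  let ?G = "S \<rightarrow>\<^sub>E A"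
  let ?swap = "\<lambda>(g, v). (g(b := v), g b)"
  have "(\<Sum>g\<in>?G. \<Sum>v\<in>A. f (g(b := v))) = (\<Sum>(g, v)\<in>?G \<times> A. f (g(b := v)))"
    by (rule sum.cartesian_product)
  also have "\<dots> = (\<Sum>(g, v)\<in>?G \<times> A. f g)"
    using assms by (intro sum.reindex_bij_witness[of _ ?swap ?swap]) (auto simp: PiE_def Pi_def extensional_def)
  also have "\<dots> = (\<Sum>g\<in>?G. \<Sum>v\<in>A. f g)"
    by (rule sum.cartesian_product[symmetric])
  finally show ?thesis by (simp add: sum_distrib_left)
qed

definition scaled_identity :: "nat \<Rightarrow> nat \<Rightarrow> real \<Rightarrow> real mat" where
  "scaled_identity n d B = mat n d (\<lambda>(i, j). if i = j then sqrt (real n / B) else 0)"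

text \<open>The least informative design: it meets the defining constraint with equality, its Gram matrix being
\<open>n / B\<close> times the identity.\<close>

lemma scaled_identity_designs:
  assumes "1 \<le> d" "d \<le> n" "0 < B"
  shows "scaled_identity n d B \<in> designs n d B"
proof -
  let ?X = "scaled_identity n d B"
  have X: "?X \<in> carrier_mat n d" by (simp add: scaled_identity_def)
  have gram: "(\<Sum>k = 0..<n. (if k = i then sqrt (real n / B) else 0) * (if k = j then sqrt (real n / B) else 0))
      = (if i = j then real n / B else 0)" if "i < d" for i j
  proof -
    have "(\<Sum>k = 0..<n. (if k = i then sqrt (real n / B) else 0) * (if k = j then sqrt (real n / B) else 0))
       = (\<Sum>k = 0..<n. if k = i then (if i = j then sqrt (real n / B) * sqrt (real n / B) else 0) else 0)"
      by (intro sum.cong) auto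
    also have "\<dots> = (if i = j then sqrt (real n / B) * sqrt (real n / B) else 0)"
      using assms that by simp
    finally show ?thesis using assms by simp
  qed
  have "(1 / real n) \<cdot>\<^sub>m (transpose_mat ?X * ?X) - (1 / B) \<cdot>\<^sub>m 1\<^sub>m d = 0\<^sub>m d d"
    using assms gram
    by (intro eq_matI) (auto simp: scaled_identity_def scalar_prod_def)
  moreover have "0\<^sub>m d d *\<^sub>v v = 0\<^sub>v d" if "v \<in> carrier_vec d" for v :: "real vec"
    using that by (intro eq_vecI) (auto simp: scalar_prod_def)
  ultimately show ?thesis
    using X by (auto simp: designs_def psd_mat_def)
qed

lemma scaled_identity_mult_vec:
  assumes "\<theta> \<in> carrier_vec d" "i < n"
  shows "(scaled_identity n d B *\<^sub>v \<theta>) $ i = (if i < d then sqrt (real n / B) * \<theta> $ i else 0)"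
proof -
  have "(scaled_identity n d B *\<^sub>v \<theta>) $ i = (\<Sum>k = 0..<d. (if i = k then sqrt (real n / B) else 0) * \<theta> $ k)"
    using assms by (simp add: scaled_identity_def scalar_prod_def)
  also have "\<dots> = (\<Sum>k = 0..<d. if k = i then sqrt (real n / B) * \<theta> $ i else 0)"
    by (intro sum.cong) auto
  finally have "(scaled_identity n d B *\<^sub>v \<theta>) $ i = \<dots>" .
  then show ?thesis by simp
qed

text \<open>The prior draws \<open>g\<close> uniformly from the functions from blocks to \<open>{..<2 * m}\<close>. A value below \<open>m\<close> is a
position inside the block, and the remaining \<open>m\<close> values leave the block zero; so zero blocks get
probability \<open>1/2\<close> under a uniform prior, and averages over it are plain finite sums.\<close>

definition block_sparse :: "nat \<Rightarrow> nat \<Rightarrow> nat \<Rightarrow> real \<Rightarrow> (nat \<Rightarrow> nat) \<Rightarrow> real vec" where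
  "block_sparse d s m \<delta> g = vec d (\<lambda>i. if i < s * m \<and> g (i div m) = i mod m then \<delta> else 0)"

lemma block_sparse_card:
  "card {i. i < d \<and> block_sparse d s m \<delta> g $ i \<noteq> 0} \<le> s"
proof -
  have "{i. i < d \<and> block_sparse d s m \<delta> g $ i \<noteq> 0} \<subseteq> (\<lambda>b. b * m + g b) ` {..<s}"
  proof
    fix i assume i: "i \<in> {i. i < d \<and> block_sparse d s m \<delta> g $ i \<noteq> 0}"
    then have "i < s * m" "g (i div m) = i mod m"
      by (auto simp: block_sparse_def split: if_splits)
    then show "i \<in> (\<lambda>b. b * m + g b) ` {..<s}"
      by (intro image_eqI[of _ _ "i div m"]) (auto simp: less_mult_imp_div_less)
  qed
  from card_mono[OF _ this] have "card {i. i < d \<and> block_sparse d s m \<delta> g $ i \<noteq> 0} \<le> card ((\<lambda>b. b * m + g b) ` {..<s})"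
    by simp
  also have "\<dots> \<le> s" using card_image_le[of "{..<s}"] by force
  finally show ?thesis .
qed

text \<open>The worst case risk is at least the average over the block prior. Resampling the block that contains
a coordinate \<open>i\<close> turns the average risk at \<open>i\<close> into the two-point problem of weights \<open>m\<close> (block zero)
against \<open>1\<close> (entry \<open>\<delta>\<close> at \<open>i\<close>); the other positions in the block are discarded. Each of the
\<open>s m\<close> coordinates then contributes at least \<open>\<delta>\<^sup>2 / (2 m (1 + e))\<close> to the average.\<close>

lemma minimax_risk_ge_blocks:
  assumes "0 < \<sigma>" "0 < B" "1 \<le> d" "d \<le> n" "1 \<le> m" "s * m \<le> d"
    and close: "exp (\<delta>\<^sup>2 * real n / (\<sigma>\<^sup>2 * B)) \<le> exp 1 * real m"
    and ball: "\<And>\<theta>. \<theta> \<in> carrier_vec d \<Longrightarrow> card {i. i < d \<and> \<theta> $ i \<noteq> 0} \<le> s \<Longrightarrow>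
      (\<And>i. i < d \<Longrightarrow> \<theta> $ i \<in> {0, \<delta>}) \<Longrightarrow> \<theta> \<in> lp_ball d p R"
  shows "ennreal (real s * \<delta>\<^sup>2 / (2 * (1 + exp 1))) \<le> minimax_risk n d p \<sigma> R B"
  unfolding minimax_risk_def
proof (rule INF_greatest)
  fix T assume T: "T \<in> estimators n d"
  let ?M = "SUP (X, \<theta>) \<in> designs n d B \<times> lp_ball d p R. risk T \<sigma> X \<theta>"
  define X where "X = scaled_identity n d B"
  have X: "X \<in> designs n d B" "X \<in> carrier_mat n d"
    using scaled_identity_designs[OF \<open>1 \<le> d\<close> \<open>d \<le> n\<close> \<open>0 < B\<close>] by (auto simp: X_def designs_def)
  define \<theta> where "\<theta> = block_sparse d s m \<delta>"
  have \<theta>: "\<theta> g \<in> carrier_vec d" for g by (simp add: \<theta>_def block_sparse_def)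
  define r where "r g i = (\<integral>\<^sup>+ y. ennreal ((T X y $ i - \<theta> g $ i)\<^sup>2) \<partial>normal_vec (X *\<^sub>v \<theta> g) \<sigma>)" for g i
  define G where "G = {..<s} \<rightarrow>\<^sub>E {..<2 * m}"
  define \<epsilon> where "\<epsilon> = ennreal (\<delta>\<^sup>2 / (1 + exp 1))"
  have G: "finite G" "card G \<noteq> 0"
    using \<open>1 \<le> m\<close> by (auto simp: G_def card_PiE intro!: finite_PiE)
  have risk_le: "(\<Sum>i<d. r g i) \<le> ?M" for g
  proof -
    have "\<theta> g \<in> lp_ball d p R"
    proof (rule ball[OF \<theta>])
      show "card {i. i < d \<and> \<theta> g $ i \<noteq> 0} \<le> s"
        unfolding \<theta>_def by (rule block_sparse_card)
    qed (auto simp: \<theta>_def block_sparse_def)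
    then show ?thesis
      unfolding r_def risk_eq_sum[OF T X(2) \<theta>, symmetric]
      using X(1) by (intro SUP_upper2[of "(X, \<theta> g)"]) auto
  qed
  have pair: "\<epsilon> \<le> (\<Sum>v<2 * m. r (g(i div m := v)) i)" if i: "i < s * m" for g i
  proof -
    define b k where "b = i div m" and "k = i mod m"
    have k: "k < m" using \<open>1 \<le> m\<close> by (simp add: k_def)
    have id: "i < d" "i < n" using i assms by auto
    let ?g0 = "g(b := m)" and ?g1 = "g(b := k)"
    have nz: "j mod m \<noteq> v" "v \<noteq> j mod m" if "m \<le> v" for j v
      using \<open>1 \<le> m\<close> that mod_less_divisor[of m j] by linarith+
    have \<theta>i: "\<theta> ?g0 $ i = 0" "\<theta> ?g1 $ i = \<delta>"
      using id i nz[OF order_refl, of i] by (auto simp: \<theta>_def block_sparse_def b_def k_def)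
    have \<theta>j: "\<theta> ?g0 $ j = \<theta> ?g1 $ j" if "j < d" "j \<noteq> i" for j
    proof (cases "j div m = b")
      case True
      then have "j mod m \<noteq> k"
        using that(2) div_mult_mod_eq[of j m] div_mult_mod_eq[of i m] by (auto simp: b_def k_def)
      then show ?thesis using True that nz[of m j] by (auto simp: \<theta>_def block_sparse_def)
    qed (auto simp: \<theta>_def block_sparse_def that)
    have "\<epsilon> \<le> ennreal (real m) * (\<integral>\<^sup>+ y. ennreal ((T X y $ i)\<^sup>2) \<partial>normal_vec (X *\<^sub>v \<theta> ?g0) \<sigma>)
        + (\<integral>\<^sup>+ y. ennreal ((T X y $ i - \<delta>)\<^sup>2) \<partial>normal_vec (X *\<^sub>v \<theta> ?g1) \<sigma>)"
      unfolding \<epsilon>_def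
    proof (rule normal_vec_two_point_bound[OF _ \<open>0 < \<sigma>\<close> _ \<open>i < n\<close>])
      show "(\<lambda>y. T X y $ i) \<in> borel_measurable (borel_vec n)"
        using measurable_estimator_component[OF T X(2) id(1)] .
      show "(X *\<^sub>v \<theta> ?g0) $ j = (X *\<^sub>v \<theta> ?g1) $ j" if "j < n" "j \<noteq> i" for j
        using that \<theta>j by (simp add: X_def scaled_identity_mult_vec \<theta>)
      have "((X *\<^sub>v \<theta> ?g1) $ i - (X *\<^sub>v \<theta> ?g0) $ i)\<^sup>2 / \<sigma>\<^sup>2 = \<delta>\<^sup>2 * real n / (\<sigma>\<^sup>2 * B)"
        using id \<theta>i assms by (simp add: X_def scaled_identity_mult_vec \<theta> power_mult_distrib field_simps)
      then show "exp (((X *\<^sub>v \<theta> ?g1) $ i - (X *\<^sub>v \<theta> ?g0) $ i)\<^sup>2 / \<sigma>\<^sup>2) \<le> exp 1 * real m"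
        using close by simp
    qed (use X \<theta> \<open>1 \<le> m\<close> in auto)
    also have "\<dots> = of_nat m * r ?g0 i + r ?g1 i"
      by (simp add: r_def \<theta>i ennreal_of_nat_eq_real_of_nat)
    also have "of_nat m * r ?g0 i = (\<Sum>v\<in>{m..<2 * m}. r (g(b := v)) i)"
    proof -
      have blank: "\<theta> (g(b := v)) = \<theta> ?g0" if "m \<le> v" for v
      proof (rule eq_vecI)
        fix j
        have same: "(g(b := v)) (j div m) = j mod m \<longleftrightarrow> ?g0 (j div m) = j mod m"
          using nz(2)[OF \<open>m \<le> v\<close>, of j] nz(2)[OF order_refl, of j] unfolding fun_upd_apply by metis
        show "\<theta> (g(b := v)) $ j = \<theta> ?g0 $ j" if "j < dim_vec (\<theta> ?g0)"
          using that by (simp only: \<theta>_def block_sparse_def index_vec dim_vec same)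
      qed (simp add: \<theta>_def block_sparse_def)
      have "(\<Sum>v\<in>{m..<2 * m}. r (g(b := v)) i) = (\<Sum>v\<in>{m..<2 * m}. r ?g0 i)"
      proof (rule sum.cong[OF refl])
        fix v assume "v \<in> {m..<2 * m}"
        then have "m \<le> v" by simp
        from blank[OF this] show "r (g(b := v)) i = r ?g0 i" by (simp only: r_def)
      qed
      then show ?thesis by simp
    qed
    also have "r ?g1 i \<le> (\<Sum>v<m. r (g(b := v)) i)"
      using k by (intro member_le_sum) auto
    also have "(\<Sum>v\<in>{m..<2 * m}. r (g(b := v)) i) + (\<Sum>v<m. r (g(b := v)) i) = (\<Sum>v<2 * m. r (g(b := v)) i)"
      by (subst sum.union_disjoint[symmetric]) (auto intro!: sum.cong)
    finally show ?thesis by (auto simp: b_def)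
  qed
  have coord: "of_nat (card G) * \<epsilon> \<le> of_nat (2 * m) * (\<Sum>g\<in>G. r g i)" if "i < s * m" for i
  proof -
    have "of_nat (card G) * \<epsilon> = (\<Sum>g\<in>G. \<epsilon>)" by simp
    also have "\<dots> \<le> (\<Sum>g\<in>G. \<Sum>v<2 * m. r (g(i div m := v)) i)"
      by (intro sum_mono pair that)
    also have "\<dots> = of_nat (2 * m) * (\<Sum>g\<in>G. r g i)"
      unfolding G_def using that
      by (subst sum_PiE_resample) (auto simp: less_mult_imp_div_less)
    finally show ?thesis .
  qed
  have "of_nat (card G * m) * (of_nat s * \<epsilon>) = (\<Sum>i<s * m. of_nat (card G) * \<epsilon>)"
    by (simp add: mult_ac)
  also have "\<dots> \<le> (\<Sum>i<s * m. of_nat (2 * m) * (\<Sum>g\<in>G. r g i))"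
    by (intro sum_mono coord) simp
  also have "\<dots> = of_nat (2 * m) * (\<Sum>g\<in>G. \<Sum>i<s * m. r g i)"
    by (subst sum.swap) (simp add: sum_distrib_left)
  also have "\<dots> \<le> of_nat (2 * m) * (\<Sum>g\<in>G. ?M)"
    using \<open>s * m \<le> d\<close>
    by (intro mult_left_mono sum_mono order_trans[OF sum_mono2 risk_le]) auto
  also have "\<dots> = of_nat (card G * m) * (2 * ?M)" by (simp add: mult_ac)
  finally have "of_nat s * \<epsilon> \<le> 2 * ?M"
    using G \<open>1 \<le> m\<close> by (subst (asm) ennreal_mult_le_mult_iff) (auto simp del: of_nat_mult)
  also have "of_nat s * \<epsilon> = 2 * ennreal (real s * \<delta>\<^sup>2 / (2 * (1 + exp 1)))"
  proof -
    have "real s * (\<delta>\<^sup>2 / h) = 2 * (real s * \<delta>\<^sup>2 / (2 * h))" if "0 < h" for h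
      using that by (simp add: field_simps)
    from this[of "1 + exp 1"] have "real s * (\<delta>\<^sup>2 / (1 + exp 1)) = 2 * (real s * \<delta>\<^sup>2 / (2 * (1 + exp 1)))"
      by (simp add: add_pos_pos)
    then have "ennreal (real s * (\<delta>\<^sup>2 / (1 + exp 1))) = ennreal (2 * (real s * \<delta>\<^sup>2 / (2 * (1 + exp 1))))"
      by (rule arg_cong)
    then show ?thesis
      unfolding \<epsilon>_def ennreal_of_nat_eq_real_of_nat by (simp only: ennreal_mult' of_nat_0_le_iff ennreal_numeral zero_le_numeral)
  qed
  finally show "ennreal (real s * \<delta>\<^sup>2 / (2 * (1 + exp 1))) \<le> ?M"
    by (subst (asm) ennreal_mult_le_mult_iff) auto
qed

section \<open>Soft thresholding of least squares\<close>

lemma gaussian_mgf: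
  assumes "0 < \<sigma>"
  shows "(\<integral>\<^sup>+ y. ennreal (exp (t * y)) \<partial>gaussian \<mu> \<sigma>) = ennreal (exp (t * \<mu> + t\<^sup>2 * \<sigma>\<^sup>2 / 2))"
proof -
  have shift: "normal_density \<mu> \<sigma> y * exp (t * y)
      = exp (t * \<mu> + t\<^sup>2 * \<sigma>\<^sup>2 / 2) * normal_density (\<mu> + t * \<sigma>\<^sup>2) \<sigma> y" for y
  proof -
    have "-(y - \<mu>)\<^sup>2 / (2 * \<sigma>\<^sup>2) + t * y
        = (t * \<mu> + t\<^sup>2 * \<sigma>\<^sup>2 / 2) + (-(y - (\<mu> + t * \<sigma>\<^sup>2))\<^sup>2 / (2 * \<sigma>\<^sup>2))"
      using assms by (simp add: field_simps power2_eq_square)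
    then show ?thesis
      by (simp add: normal_density_def exp_add[symmetric] del: exp_add)
  qed
  have "(\<integral>\<^sup>+ y. ennreal (exp (t * y)) \<partial>gaussian \<mu> \<sigma>)
      = (\<integral>\<^sup>+ y. ennreal (exp (t * \<mu> + t\<^sup>2 * \<sigma>\<^sup>2 / 2)) * ennreal (normal_density (\<mu> + t * \<sigma>\<^sup>2) \<sigma> y) \<partial>lborel)"
    by (subst nn_integral_density) (auto simp: ennreal_mult[symmetric] shift)
  also have "\<dots> = ennreal (exp (t * \<mu> + t\<^sup>2 * \<sigma>\<^sup>2 / 2))"
    using assms by (subst nn_integral_cmult) (auto simp: nn_integral_normal_density)
  finally show ?thesis .
qed

lemma normal_vec_mgf:
  assumes "0 < \<sigma>" and a: "a \<in> carrier_vec n" and \<mu>: "\<mu> \<in> carrier_vec n"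
  shows "(\<integral>\<^sup>+ y. ennreal (exp (t * (scalar_prod a y - scalar_prod a \<mu>))) \<partial>normal_vec \<mu> \<sigma>)
    = ennreal (exp (t\<^sup>2 * \<sigma>\<^sup>2 * scalar_prod a a / 2))"
proof -
  interpret product_sigma_finite "\<lambda>i. gaussian (\<mu> $ i) \<sigma>"
    using assms(1) by (rule product_sigma_finite_gaussian)
  have one: "(\<integral>\<^sup>+ y. ennreal (exp (t * (a $ i * (y - \<mu> $ i)))) \<partial>gaussian (\<mu> $ i) \<sigma>)
      = ennreal (exp (t\<^sup>2 * \<sigma>\<^sup>2 * (a $ i)\<^sup>2 / 2))" for i
  proof -
    have "(\<integral>\<^sup>+ y. ennreal (exp (t * (a $ i * (y - \<mu> $ i)))) \<partial>gaussian (\<mu> $ i) \<sigma>)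
        = (\<integral>\<^sup>+ y. ennreal (exp (- t * a $ i * \<mu> $ i)) * ennreal (exp ((t * a $ i) * y)) \<partial>gaussian (\<mu> $ i) \<sigma>)"
      by (simp add: ennreal_mult[symmetric] exp_add[symmetric] algebra_simps)
    also have "\<dots> = ennreal (exp (- t * a $ i * \<mu> $ i))
        * ennreal (exp ((t * a $ i) * \<mu> $ i + (t * a $ i)\<^sup>2 * \<sigma>\<^sup>2 / 2))"
      by (subst nn_integral_cmult) (use assms(1) in \<open>auto simp: gaussian_mgf\<close>)
    also have "\<dots> = ennreal (exp (t\<^sup>2 * \<sigma>\<^sup>2 * (a $ i)\<^sup>2 / 2))"
      by (simp add: ennreal_mult[symmetric] exp_add[symmetric] power_mult_distrib mult_ac)
    finally show ?thesis .
  qed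
  have [measurable]: "(\<lambda>y. scalar_prod a y) \<in> borel_measurable (borel_vec n)"
    using a by (rule measurable_scalar_prod)
  have "(\<integral>\<^sup>+ y. ennreal (exp (t * (scalar_prod a y - scalar_prod a \<mu>))) \<partial>normal_vec \<mu> \<sigma>)
      = (\<integral>\<^sup>+ x. ennreal (exp (t * (scalar_prod a (vec n x) - scalar_prod a \<mu>)))
          \<partial>(\<Pi>\<^sub>M i\<in>{..<n}. gaussian (\<mu> $ i) \<sigma>))"
    using \<mu> by (rule nn_integral_normal_vec) measurable
  also have "\<dots> = (\<integral>\<^sup>+ x. (\<Prod>i<n. ennreal (exp (t * (a $ i * (x i - \<mu> $ i)))))
          \<partial>(\<Pi>\<^sub>M i\<in>{..<n}. gaussian (\<mu> $ i) \<sigma>))"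
  proof (rule nn_integral_cong)
    fix x
    have "t * (scalar_prod a (vec n x) - scalar_prod a \<mu>) = (\<Sum>i<n. t * (a $ i * (x i - \<mu> $ i)))"
      using a \<mu> by (simp add: scalar_prod_def atLeast0LessThan sum_subtractf[symmetric]
          sum_distrib_left right_diff_distrib)
    then show "ennreal (exp (t * (scalar_prod a (vec n x) - scalar_prod a \<mu>)))
        = (\<Prod>i<n. ennreal (exp (t * (a $ i * (x i - \<mu> $ i)))))"
      by (simp add: exp_sum prod_ennreal)
  qed
  also have "\<dots> = (\<Prod>i<n. ennreal (exp (t\<^sup>2 * \<sigma>\<^sup>2 * (a $ i)\<^sup>2 / 2)))"
    by (subst product_nn_integral_prod) (auto simp: one)
  also have "\<dots> = ennreal (exp (t\<^sup>2 * \<sigma>\<^sup>2 * scalar_prod a a / 2))"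
    using a by (simp add: prod_ennreal exp_sum[symmetric] scalar_prod_def atLeast0LessThan
        sum_distrib_left sum_divide_distrib power2_eq_square mult_ac)
  finally show ?thesis .
qed

text \<open>The bound \<open>u\<^sup>2 / 2 \<le> exp u\<close> for \<open>u \<ge> 0\<close>, at \<open>u = t (z - l)\<close>, reduces the truncated second moment to
the moment generating function; \<open>t = l / \<omega>\<^sup>2\<close> minimises the exponent.\<close>

lemma normal_vec_excess:
  assumes "0 < \<sigma>" and a: "a \<in> carrier_vec n" and \<mu>: "\<mu> \<in> carrier_vec n"
    and "0 < \<omega>" "\<sigma>\<^sup>2 * scalar_prod a a \<le> \<omega>\<^sup>2" "0 < l" "2 * \<omega>\<^sup>2 \<le> l\<^sup>2"
  shows "(\<integral>\<^sup>+ y. ennreal ((max 0 (scalar_prod a y - scalar_prod a \<mu> - l))\<^sup>2) \<partial>normal_vec \<mu> \<sigma>)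
    \<le> ennreal (\<omega>\<^sup>2 * exp (- (l\<^sup>2 / (2 * \<omega>\<^sup>2))))"
proof -
  define t where "t = l / \<omega>\<^sup>2"
  have t: "0 < t" using assms by (simp add: t_def)
  have sq: "(max 0 (z - l))\<^sup>2 \<le> 2 / t\<^sup>2 * exp (- t * l) * exp (t * z)" for z
  proof (cases "l \<le> z")
    case True
    then have "(t * (z - l))\<^sup>2 / 2 \<le> exp (t * (z - l))"
      using exp_lower_Taylor_quadratic[of "t * (z - l)"] t
      by (smt (verit) mult_nonneg_nonneg)
    then have "(z - l)\<^sup>2 \<le> 2 / t\<^sup>2 * exp (t * (z - l))"
      using t by (simp only: power_mult_distrib) (simp add: divide_simps mult.commute)
    also have "exp (t * (z - l)) = exp (- t * l) * exp (t * z)"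
      by (simp add: exp_add[symmetric] algebra_simps)
    finally show ?thesis using True by (simp add: mult.assoc)
  qed (auto simp: max_def)
  have [measurable]: "(\<lambda>y. scalar_prod a y) \<in> borel_measurable (normal_vec \<mu> \<sigma>)"
    using measurable_scalar_prod[OF a] \<mu> by (simp add: normal_vec_def carrier_vecD)
  have "(\<integral>\<^sup>+ y. ennreal ((max 0 (scalar_prod a y - scalar_prod a \<mu> - l))\<^sup>2) \<partial>normal_vec \<mu> \<sigma>)
     \<le> (\<integral>\<^sup>+ y. ennreal (2 / t\<^sup>2 * exp (- t * l)) * ennreal (exp (t * (scalar_prod a y - scalar_prod a \<mu>)))
          \<partial>normal_vec \<mu> \<sigma>)"
  proof (rule nn_integral_mono)
    fix y
    show "ennreal ((max 0 (scalar_prod a y - scalar_prod a \<mu> - l))\<^sup>2)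
        \<le> ennreal (2 / t\<^sup>2 * exp (- t * l)) * ennreal (exp (t * (scalar_prod a y - scalar_prod a \<mu>)))"
      by (subst ennreal_mult[symmetric]) (auto intro!: ennreal_leI sq[simplified])
  qed
  also have "\<dots> = ennreal (2 / t\<^sup>2 * exp (- t * l)) * ennreal (exp (t\<^sup>2 * \<sigma>\<^sup>2 * scalar_prod a a / 2))"
    using assms by (subst nn_integral_cmult) (auto simp: normal_vec_mgf)
  also have "\<dots> = ennreal (2 / t\<^sup>2 * exp (- t * l + t\<^sup>2 * (\<sigma>\<^sup>2 * scalar_prod a a) / 2))"
    by (subst ennreal_mult[symmetric]) (simp_all add: exp_add[symmetric] algebra_simps del: exp_add)
  also have "\<dots> \<le> ennreal (\<omega>\<^sup>2 * exp (- (l\<^sup>2 / (2 * \<omega>\<^sup>2))))"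
  proof (intro ennreal_leI mult_mono)
    show "2 / t\<^sup>2 \<le> \<omega>\<^sup>2"
    proof -
      have "2 / t\<^sup>2 = \<omega>\<^sup>2 * (2 * \<omega>\<^sup>2 / l\<^sup>2)"
        using assms by (simp add: t_def field_simps power2_eq_square)
      also have "\<dots> \<le> \<omega>\<^sup>2 * 1" using assms by (intro mult_left_mono) auto
      finally show ?thesis by simp
    qed
    have "t\<^sup>2 * (\<sigma>\<^sup>2 * scalar_prod a a) \<le> t\<^sup>2 * \<omega>\<^sup>2"
      using assms by (intro mult_left_mono) auto
    moreover have "- t * l + t\<^sup>2 * \<omega>\<^sup>2 / 2 = - (l\<^sup>2 / (2 * \<omega>\<^sup>2))"
      using assms by (simp add: t_def field_simps power2_eq_square)
    ultimately show "exp (- t * l + t\<^sup>2 * (\<sigma>\<^sup>2 * scalar_prod a a) / 2) \<le> exp (- (l\<^sup>2 / (2 * \<omega>\<^sup>2)))"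
      by (simp only: exp_le_cancel_iff)
  qed auto
  finally show ?thesis .
qed

lemma designs_coercive:
  assumes "X \<in> designs n d B" "1 \<le> n" "0 < B" and v: "v \<in> carrier_vec d"
  shows "real n / B * scalar_prod v v \<le> scalar_prod v ((transpose_mat X * X) *\<^sub>v v)"
proof -
  have X: "X \<in> carrier_mat n d" and M: "transpose_mat X * X \<in> carrier_mat d d"
    using assms(1) by (auto simp: designs_def)
  let ?M = "transpose_mat X * X"
  have smult: "(k \<cdot>\<^sub>m A) *\<^sub>v v = k \<cdot>\<^sub>v (A *\<^sub>v v)" if "A \<in> carrier_mat d d" for k and A :: "real mat"
    using that v by (intro eq_vecI) (auto simp: scalar_prod_def sum_distrib_left mult.assoc)
  have "0 \<le> scalar_prod v (((1 / real n) \<cdot>\<^sub>m ?M - (1 / B) \<cdot>\<^sub>m 1\<^sub>m d) *\<^sub>v v)"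
    using assms by (auto simp: designs_def psd_mat_def)
  also have "((1 / real n) \<cdot>\<^sub>m ?M - (1 / B) \<cdot>\<^sub>m 1\<^sub>m d) *\<^sub>v v = (1 / real n) \<cdot>\<^sub>v (?M *\<^sub>v v) - (1 / B) \<cdot>\<^sub>v v"
    using M v by (subst minus_mult_distrib_mat_vec[of _ d d]) (auto simp: smult)
  also have "scalar_prod v \<dots> = (1 / real n) * scalar_prod v (?M *\<^sub>v v) - (1 / B) * scalar_prod v v"
    using M v by (subst scalar_prod_minus_distrib[of _ d]) auto
  finally show ?thesis using assms(2,3) by (simp add: field_simps)
qed

text \<open>Row \<open>j\<close> of the least squares map: with the invertible Gram matrix \<open>M = X\<^sup>T X\<close> and \<open>M w = e\<^sub>j\<close>, the
vector \<open>a = X w\<close> is unbiased for coordinate \<open>j\<close> and \<open>\<bar>a\<bar>\<^sup>2 = w\<^sub>j =: t\<close>. Coercivity gives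
\<open>(n / B) t\<^sup>2 \<le> (n / B) \<bar>w\<bar>\<^sup>2 \<le> t\<close>, hence the variance bound.\<close>

lemma design_unbiased_row:
  assumes X: "X \<in> designs n d B" and "1 \<le> n" "0 < B" "j < d"
  shows "\<exists>a \<in> carrier_vec n. (\<forall>\<theta> \<in> carrier_vec d. scalar_prod a (X *\<^sub>v \<theta>) = \<theta> $ j)
    \<and> scalar_prod a a \<le> B / real n"
proof -
  let ?M = "transpose_mat X * X"
  have Xc: "X \<in> carrier_mat n d" and M: "?M \<in> carrier_mat d d"
    using X by (auto simp: designs_def)
  have nB: "real n / B > 0" using assms by simp
  have "det ?M \<noteq> 0"
  proof
    assume "det ?M = 0"
    then obtain v where v: "v \<in> carrier_vec d" "v \<noteq> 0\<^sub>v d" "?M *\<^sub>v v = 0\<^sub>v d"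
      using det_0_iff_vec_prod_zero_field[OF M] by auto
    then have "real n / B * scalar_prod v v \<le> 0"
      using designs_coercive[OF X assms(2,3) v(1)] by simp
    then have "scalar_prod v v \<le> 0" using nB by (metis mult_pos_pos not_le)
    then have "(\<Sum>i = 0..<d. v $ i * v $ i) \<le> 0" using v(1) by (simp add: scalar_prod_def)
    then have "(\<Sum>i = 0..<d. v $ i * v $ i) = 0" by (intro antisym sum_nonneg) auto
    then have "\<forall>i<d. v $ i = 0" by (subst (asm) sum_nonneg_eq_0_iff) auto
    then have "v = 0\<^sub>v d" using v(1) by (intro eq_vecI) auto
    then show False using v(2) by simp
  qed
  from det_non_zero_imp_unit[OF M this, of undefined]
  obtain W where W: "W \<in> carrier_mat d d" "?M * W = 1\<^sub>m d"
    by (auto simp: Units_def ring_mat_def)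
  define w where "w = W *\<^sub>v unit_vec d j"
  have w: "w \<in> carrier_vec d" using W by (simp add: w_def)
  have Mw: "?M *\<^sub>v w = unit_vec d j"
    unfolding w_def using M W by (subst assoc_mult_mat_vec[symmetric, of _ d d _ d]) auto
  define a where "a = X *\<^sub>v w"
  have a: "a \<in> carrier_vec n" using Xc w by (simp add: a_def)
  have Xa: "transpose_mat X *\<^sub>v a = unit_vec d j"
    unfolding a_def Mw[symmetric] using Xc w by (subst assoc_mult_mat_vec[of _ d n _ d]) auto
  have inner: "scalar_prod a (X *\<^sub>v \<theta>) = \<theta> $ j" if \<theta>: "\<theta> \<in> carrier_vec d" for \<theta>
    using transpose_vec_mult_scalar[OF Xc \<theta> a] \<theta> \<open>j < d\<close> by (simp add: Xa)
  have "scalar_prod a a \<le> B / real n"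
  proof -
    define t where "t = w $ j"
    have aa: "scalar_prod a a = t" using inner[OF w] by (simp add: a_def t_def)
    have "t * t \<le> (\<Sum>i = 0..<d. w $ i * w $ i)"
      unfolding t_def using \<open>j < d\<close> by (intro member_le_sum[of j _ "\<lambda>i. w $ i * w $ i"]) auto
    then have "t * t \<le> scalar_prod w w" using w by (simp add: scalar_prod_def)
    then have "real n / B * (t * t) \<le> real n / B * scalar_prod w w"
      using nB by (intro mult_left_mono) auto
    also have "\<dots> \<le> t"
      using designs_coercive[OF X assms(2,3) w] w \<open>j < d\<close> by (simp add: Mw t_def)
    finally have *: "real n / B * t * t \<le> 1 * t" by simp
    show ?thesis
    proof (cases "0 < t")
      case True
      then have "real n / B * t \<le> 1" using * by (simp only: mult_le_cancel_right)
      then show ?thesis using assms unfolding aa by (simp add: field_simps)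
    next
      case False
      then show ?thesis using assms unfolding aa by (smt (verit) divide_nonneg_nonneg of_nat_0_le_iff)
    qed
  qed
  with a inner show ?thesis by blast
qed

text \<open>Soft thresholding, written as the identity minus the projection onto \<open>[-l, l]\<close>.\<close>

definition soft_threshold :: "real \<Rightarrow> real \<Rightarrow> real" where
  "soft_threshold l x = x - max (- l) (min l x)"

lemma borel_measurable_soft_threshold [measurable]:
  "soft_threshold l \<in> borel_measurable borel"
  unfolding soft_threshold_def by measurable

text \<open>When \<open>\<bar>z\<bar> \<le> l\<close>, the thresholded value lies between \<open>0\<close> and \<open>\<theta>\<close> and within \<open>2 l\<close> of \<open>\<theta>\<close>. Since soft
thresholding is a contraction, larger noise adds at most its excess over \<open>l\<close> to the error.\<close>

lemma soft_threshold_error: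
  assumes "0 \<le> l"
  shows "(soft_threshold l (\<theta> + z) - \<theta>)\<^sup>2
    \<le> 8 * min (\<theta>\<^sup>2) (l\<^sup>2) + 2 * (max 0 (z - l))\<^sup>2 + 2 * (max 0 (- z - l))\<^sup>2"
proof -
  define a where "a = min \<bar>\<theta>\<bar> (2 * l)"
  define b where "b = max 0 (\<bar>z\<bar> - l)"
  have "\<bar>soft_threshold l (\<theta> + z) - \<theta>\<bar> \<le> a + b"
    using assms unfolding soft_threshold_def a_def b_def by linarith
  then have "(soft_threshold l (\<theta> + z) - \<theta>)\<^sup>2 \<le> (a + b)\<^sup>2"
    by (rule power2_le_iff_abs_le[THEN iffD2, rotated]) (use assms in \<open>simp add: a_def b_def\<close>)
  also have "\<dots> \<le> 2 * a\<^sup>2 + 2 * b\<^sup>2"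
    using zero_le_power2[of "a - b"] by (simp add: power2_eq_square algebra_simps)
  also have "a\<^sup>2 \<le> 4 * min (\<theta>\<^sup>2) (l\<^sup>2)"
  proof -
    have "a\<^sup>2 \<le> \<bar>\<theta>\<bar>\<^sup>2" "a\<^sup>2 \<le> (2 * l)\<^sup>2"
      by (rule power_mono; use assms in \<open>simp add: a_def\<close>)+
    moreover from this have "a\<^sup>2 \<le> 4 * \<theta>\<^sup>2"
      using zero_le_power2[of \<theta>] unfolding power2_abs by linarith
    ultimately show ?thesis by (simp add: min_def power_mult_distrib)
  qed
  also have "b\<^sup>2 = (max 0 (z - l))\<^sup>2 + (max 0 (- z - l))\<^sup>2"
    using assms by (auto simp: b_def max_def abs_if)
  finally show ?thesis by simp
qed

lemma soft_threshold_risk: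
  assumes "0 < \<sigma>" and a: "a \<in> carrier_vec n" and \<mu>: "\<mu> \<in> carrier_vec n"
    and \<omega>: "0 < \<omega>" "\<sigma>\<^sup>2 * scalar_prod a a \<le> \<omega>\<^sup>2" and l: "0 < l" "2 * \<omega>\<^sup>2 \<le> l\<^sup>2"
  shows "(\<integral>\<^sup>+ y. ennreal ((soft_threshold l (scalar_prod a y) - scalar_prod a \<mu>)\<^sup>2) \<partial>normal_vec \<mu> \<sigma>)
    \<le> ennreal (8 * min ((scalar_prod a \<mu>)\<^sup>2) (l\<^sup>2) + 4 * \<omega>\<^sup>2 * exp (- (l\<^sup>2 / (2 * \<omega>\<^sup>2))))"
proof -
  let ?N = "normal_vec \<mu> \<sigma>"
  let ?E = "ennreal (\<omega>\<^sup>2 * exp (- (l\<^sup>2 / (2 * \<omega>\<^sup>2))))"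
  define m where "m = scalar_prod a \<mu>"
  define up where "up y = ennreal ((max 0 (scalar_prod a y - m - l))\<^sup>2)" for y
  define dn where "dn y = ennreal ((max 0 (- (scalar_prod a y - m) - l))\<^sup>2)" for y
  interpret N: prob_space ?N using assms(1) by (rule prob_space_normal_vec)
  have [measurable]: "(\<lambda>y. scalar_prod a y) \<in> borel_measurable ?N"
    using measurable_scalar_prod[OF a] \<mu> by (simp add: normal_vec_def carrier_vecD)
  have [measurable]: "up \<in> borel_measurable ?N" "dn \<in> borel_measurable ?N"
    unfolding up_def dn_def by measurable
  have "(\<integral>\<^sup>+ y. up y \<partial>?N) \<le> ?E"
    unfolding up_def m_def by (rule normal_vec_excess[OF assms])
  moreover have "(\<integral>\<^sup>+ y. dn y \<partial>?N) \<le> ?E"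
  proof -
    have neg: "scalar_prod (- a) y = - scalar_prod a y" if "y \<in> carrier_vec n" for y
      using a that by simp
    have aa: "scalar_prod (- a) (- a) = scalar_prod a a"
      using a by simp
    have "(\<integral>\<^sup>+ y. ennreal ((max 0 (scalar_prod (- a) y - scalar_prod (- a) \<mu> - l))\<^sup>2) \<partial>?N) \<le> ?E"
      using a \<omega> by (intro normal_vec_excess[OF assms(1) _ \<mu> _ _ l]) (auto simp: aa)
    also have "(\<integral>\<^sup>+ y. ennreal ((max 0 (scalar_prod (- a) y - scalar_prod (- a) \<mu> - l))\<^sup>2) \<partial>?N) = (\<integral>\<^sup>+ y. dn y \<partial>?N)"
      using \<mu> by (intro nn_integral_cong) (auto simp: dn_def m_def neg normal_vec_def)
    finally show ?thesis .
  qed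
  moreover have "(\<integral>\<^sup>+ y. ennreal ((soft_threshold l (scalar_prod a y) - m)\<^sup>2) \<partial>?N)
      \<le> (\<integral>\<^sup>+ y. ennreal (8 * min (m\<^sup>2) (l\<^sup>2)) + 2 * up y + 2 * dn y \<partial>?N)"
  proof (rule nn_integral_mono)
    fix y
    have "ennreal ((soft_threshold l (m + (scalar_prod a y - m)) - m)\<^sup>2)
      \<le> ennreal (8 * min (m\<^sup>2) (l\<^sup>2) + 2 * (max 0 ((scalar_prod a y - m) - l))\<^sup>2
          + 2 * (max 0 (- (scalar_prod a y - m) - l))\<^sup>2)"
      using l(1) by (intro ennreal_leI soft_threshold_error) auto
    also have "\<dots> = ennreal (8 * min (m\<^sup>2) (l\<^sup>2)) + 2 * up y + 2 * dn y"
      by (simp add: up_def dn_def ennreal_plus ennreal_mult')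
    finally show "ennreal ((soft_threshold l (scalar_prod a y) - m)\<^sup>2)
        \<le> ennreal (8 * min (m\<^sup>2) (l\<^sup>2)) + 2 * up y + 2 * dn y" by simp
  qed
  moreover have "(\<integral>\<^sup>+ y. ennreal (8 * min (m\<^sup>2) (l\<^sup>2)) + 2 * up y + 2 * dn y \<partial>?N)
      = ennreal (8 * min (m\<^sup>2) (l\<^sup>2)) + 2 * (\<integral>\<^sup>+ y. up y \<partial>?N) + 2 * (\<integral>\<^sup>+ y. dn y \<partial>?N)"
    by (simp add: nn_integral_add nn_integral_cmult N.emeasure_space_1)
  moreover have "ennreal (8 * min (m\<^sup>2) (l\<^sup>2)) + 2 * (\<integral>\<^sup>+ y. up y \<partial>?N) + 2 * (\<integral>\<^sup>+ y. dn y \<partial>?N)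
      \<le> ennreal (8 * min (m\<^sup>2) (l\<^sup>2)) + 2 * ?E + 2 * ?E"
    using calculation(1,2) by (intro add_mono mult_left_mono) auto
  ultimately have "(\<integral>\<^sup>+ y. ennreal ((soft_threshold l (scalar_prod a y) - m)\<^sup>2) \<partial>?N)
      \<le> ennreal (8 * min (m\<^sup>2) (l\<^sup>2)) + 2 * ?E + 2 * ?E"
    by (simp only:)
  also have "\<dots> = ennreal (8 * min (m\<^sup>2) (l\<^sup>2) + 4 * \<omega>\<^sup>2 * exp (- (l\<^sup>2 / (2 * \<omega>\<^sup>2))))"
  proof -
    have "2 * ?E = ennreal (2 * (\<omega>\<^sup>2 * exp (- (l\<^sup>2 / (2 * \<omega>\<^sup>2)))))"
      by (simp add: ennreal_mult')
    then show ?thesis by (simp flip: ennreal_plus)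
  qed
  finally show ?thesis unfolding m_def .
qed

text \<open>The estimator thresholds each least squares coordinate. Each coordinate carries a bias of order
\<open>min \<bar>\<theta>\<^sub>i\<bar> l\<close> and an exponentially small contribution from noise exceeding the threshold.\<close>

lemma minimax_risk_le_threshold:
  assumes "0 < \<sigma>" "0 < B" "1 \<le> n" "0 < \<omega>" and \<omega>: "\<omega>\<^sup>2 = \<sigma>\<^sup>2 * B / real n"
    and l: "0 < l" "2 * \<omega>\<^sup>2 \<le> l\<^sup>2"
    and K: "\<And>\<theta>. \<theta> \<in> lp_ball d p R \<Longrightarrow> (\<Sum>i<d. min ((\<theta> $ i)\<^sup>2) (l\<^sup>2)) \<le> K"
  shows "minimax_risk n d p \<sigma> R B \<le> ennreal (8 * K + 4 * (real d * \<omega>\<^sup>2 * exp (- (l\<^sup>2 / (2 * \<omega>\<^sup>2)))))"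
proof -
  \<comment> \<open>Outside the designs the value is arbitrary; zero keeps the estimator measurable there.\<close>
  define row where "row X j = (if X \<in> designs n d B then
      (SOME a. a \<in> carrier_vec n \<and> (\<forall>\<theta> \<in> carrier_vec d. scalar_prod a (X *\<^sub>v \<theta>) = \<theta> $ j)
        \<and> scalar_prod a a \<le> B / real n) else 0\<^sub>v n)" for X j
  define T where "T X y = vec d (\<lambda>j. soft_threshold l (scalar_prod (row X j) y))" for X y
  have row: "row X j \<in> carrier_vec n" "\<theta> \<in> carrier_vec d \<Longrightarrow> scalar_prod (row X j) (X *\<^sub>v \<theta>) = \<theta> $ j"
    "scalar_prod (row X j) (row X j) \<le> B / real n"
    if "X \<in> designs n d B" "j < d" for X j \<theta>
    using someI_ex[OF design_unbiased_row[OF that(1) \<open>1 \<le> n\<close> \<open>0 < B\<close> that(2), unfolded Bex_def]] that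
    by (auto simp: row_def)
  have T: "T \<in> estimators n d"
    unfolding estimators_def
  proof (intro CollectI ballI measurable_into_borel_vec)
    fix X :: "real mat" and j assume "j < d"
    then have "row X j \<in> carrier_vec n" using row(1) by (cases "X \<in> designs n d B") (auto simp: row_def)
    note measurable_compose[OF measurable_scalar_prod[OF this] borel_measurable_soft_threshold, of l]
    then show "(\<lambda>y. T X y $ j) \<in> borel_measurable (borel_vec n)"
      using \<open>j < d\<close> by (simp add: T_def)
  qed (simp add: T_def)
  have "risk T \<sigma> X \<theta> \<le> ennreal (8 * K + 4 * (real d * \<omega>\<^sup>2 * exp (- (l\<^sup>2 / (2 * \<omega>\<^sup>2)))))"
    if X: "X \<in> designs n d B" and \<theta>: "\<theta> \<in> lp_ball d p R" for X \<theta>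
  proof -
    have Xc: "X \<in> carrier_mat n d" and \<theta>c: "\<theta> \<in> carrier_vec d"
      using X \<theta> by (auto simp: designs_def lp_ball_def)
    have "risk T \<sigma> X \<theta> = (\<Sum>i<d. \<integral>\<^sup>+ y. ennreal ((soft_threshold l (scalar_prod (row X i) y)
        - scalar_prod (row X i) (X *\<^sub>v \<theta>))\<^sup>2) \<partial>normal_vec (X *\<^sub>v \<theta>) \<sigma>)"
      unfolding risk_eq_sum[OF T Xc \<theta>c] by (intro sum.cong refl) (simp add: T_def row(2)[OF X _ \<theta>c])
    also have "\<dots> \<le> (\<Sum>i<d. ennreal (8 * min ((\<theta> $ i)\<^sup>2) (l\<^sup>2) + 4 * \<omega>\<^sup>2 * exp (- (l\<^sup>2 / (2 * \<omega>\<^sup>2)))))"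
    proof (rule sum_mono)
      fix i assume "i \<in> {..<d}"
      then have i: "i < d" by simp
      have "\<sigma>\<^sup>2 * scalar_prod (row X i) (row X i) \<le> \<sigma>\<^sup>2 * (B / real n)"
        using row(3)[OF X i] by (intro mult_left_mono) auto
      then show "(\<integral>\<^sup>+ y. ennreal ((soft_threshold l (scalar_prod (row X i) y)
          - scalar_prod (row X i) (X *\<^sub>v \<theta>))\<^sup>2) \<partial>normal_vec (X *\<^sub>v \<theta>) \<sigma>)
        \<le> ennreal (8 * min ((\<theta> $ i)\<^sup>2) (l\<^sup>2) + 4 * \<omega>\<^sup>2 * exp (- (l\<^sup>2 / (2 * \<omega>\<^sup>2))))"
        using soft_threshold_risk[OF assms(1) row(1)[OF X i] _ \<open>0 < \<omega>\<close> _ l, of "X *\<^sub>v \<theta>"] Xc \<theta>c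
        by (simp add: \<omega> row(2)[OF X i \<theta>c])
    qed
    also have "\<dots> = ennreal (8 * (\<Sum>i<d. min ((\<theta> $ i)\<^sup>2) (l\<^sup>2)) + 4 * (real d * \<omega>\<^sup>2 * exp (- (l\<^sup>2 / (2 * \<omega>\<^sup>2)))))"
      by (subst sum_ennreal) (auto simp: sum.distrib sum_distrib_left intro!: arg_cong[where f = ennreal])
    also have "\<dots> \<le> ennreal (8 * K + 4 * (real d * \<omega>\<^sup>2 * exp (- (l\<^sup>2 / (2 * \<omega>\<^sup>2)))))"
      using K[OF \<theta>] by (intro ennreal_leI) auto
    finally show ?thesis .
  qed
  then show ?thesis
    unfolding minimax_risk_def by (intro INF_lower2[OF T] SUP_least) auto
qed

section \<open>Rates over sparse vectors and \<open>p\<close>-balls\<close>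

text \<open>Rounding \<open>d / s\<close> down to the block length \<open>m\<close> loses at most a factor \<open>2\<close> inside the logarithm. Because
\<open>d / s \<ge> 1\<close>, the factor \<open>4\<close> in the hypothesis on \<open>\<delta>\<close> absorbs this.\<close>

lemma minimax_risk_ge_sparse:
  assumes "0 < \<sigma>" "0 < B" "1 \<le> s" "s \<le> d" "d \<le> n"
    and \<delta>: "4 * \<delta>\<^sup>2 \<le> \<sigma>\<^sup>2 * B / real n * ln (exp 1 * (real d / real s))"
    and ball: "\<And>\<theta>. \<theta> \<in> carrier_vec d \<Longrightarrow> card {i. i < d \<and> \<theta> $ i \<noteq> 0} \<le> s \<Longrightarrow>
      (\<And>i. i < d \<Longrightarrow> \<theta> $ i \<in> {0, \<delta>}) \<Longrightarrow> \<theta> \<in> lp_ball d p R"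
  shows "ennreal (real s * \<delta>\<^sup>2 / 8) \<le> minimax_risk n d p \<sigma> R B"
proof -
  define m where "m = d div s"
  define x where "x = real d / real s"
  have m: "1 \<le> m" "s * m \<le> d"
    using assms by (auto simp: m_def div_greater_zero_iff Suc_le_eq)
  have x: "1 \<le> x" using assms by (simp add: x_def)
  have "d < s * (m + 1)"
    using dividend_less_times_div[of s d] assms by (simp add: m_def algebra_simps)
  also have "\<dots> \<le> s * (2 * m)" using m by (intro mult_left_mono) auto
  finally have "real d < real (s * (2 * m))" by (simp only: of_nat_less_iff)
  then have xm: "x \<le> 2 * real m" using assms by (simp add: x_def field_simps)
  have lnx: "ln (exp 1 * x) = 1 + ln x" "0 \<le> ln x" using x by (auto simp: ln_mult)
  have "ln x \<le> ln 2 + ln (real m)"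
    using x xm m ln_mult[of 2 "real m"] ln_le_cancel_iff[of x "2 * real m"] by simp
  moreover have "4 * (\<delta>\<^sup>2 * real n / (\<sigma>\<^sup>2 * B)) \<le> ln (exp 1 * x)"
    using \<delta> assms unfolding x_def by (simp add: field_simps)
  ultimately have "\<delta>\<^sup>2 * real n / (\<sigma>\<^sup>2 * B) \<le> 1 + ln (real m)"
    using lnx ln2_le_25_over_36 by linarith
  then have "exp (\<delta>\<^sup>2 * real n / (\<sigma>\<^sup>2 * B)) \<le> exp (1 + ln (real m))" by simp
  also have "\<dots> = exp 1 * real m" using m by (simp add: exp_add)
  finally have "ennreal (real s * \<delta>\<^sup>2 / (2 * (1 + exp 1))) \<le> minimax_risk n d p \<sigma> R B"
    using assms m by (intro minimax_risk_ge_blocks) auto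
  moreover have "real s * \<delta>\<^sup>2 / 8 \<le> real s * \<delta>\<^sup>2 / (2 * (1 + exp 1))"
    using exp_le exp_gt_zero[of "1::real"] by (intro divide_left_mono) (auto simp del: exp_gt_zero)
  ultimately show ?thesis by (meson ennreal_leI order_trans)
qed

lemma lp_ball_0: "\<theta> \<in> lp_ball d 0 R \<longleftrightarrow> \<theta> \<in> carrier_vec d \<and> real (card {i. i < d \<and> \<theta> $ i \<noteq> 0}) \<le> R"
  by (auto simp: lp_ball_def lp_norm_def)

lemma lp_ball_pos:
  assumes "0 < p" "0 < R"
  shows "\<theta> \<in> lp_ball d p R \<longleftrightarrow> \<theta> \<in> carrier_vec d \<and> (\<Sum>i<d. \<bar>\<theta> $ i\<bar> powr p) \<le> R powr p"
proof -
  have "(S powr (1 / p) \<le> R) = (S \<le> R powr p)" if "0 \<le> S" for S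
  proof
    assume "S powr (1 / p) \<le> R"
    then have "(S powr (1 / p)) powr p \<le> R powr p" using assms by (intro powr_mono2) auto
    then show "S \<le> R powr p" using assms that by (simp add: powr_powr)
  next
    assume "S \<le> R powr p"
    then have "S powr (1 / p) \<le> (R powr p) powr (1 / p)" using assms that by (intro powr_mono2) auto
    then show "S powr (1 / p) \<le> R" using assms by (simp add: powr_powr)
  qed
  moreover have "0 \<le> (\<Sum>i<d. \<bar>\<theta> $ i\<bar> powr p)" by (intro sum_nonneg) auto
  ultimately show ?thesis using assms by (auto simp: lp_ball_def lp_norm_def)
qed

lemma sum_min_sq_lp_ball_0:
  assumes "\<theta> \<in> lp_ball d 0 R"
  shows "(\<Sum>i<d. min ((\<theta> $ i)\<^sup>2) (l\<^sup>2)) \<le> R * l\<^sup>2"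
proof -
  have "(\<Sum>i<d. min ((\<theta> $ i)\<^sup>2) (l\<^sup>2)) \<le> (\<Sum>i<d. if \<theta> $ i \<noteq> 0 then l\<^sup>2 else 0)"
    by (intro sum_mono) auto
  also have "\<dots> = real (card {i. i < d \<and> \<theta> $ i \<noteq> 0}) * l\<^sup>2"
    by (subst sum.inter_filter[symmetric]) (auto intro!: arg_cong[where f = card])
  also have "\<dots> \<le> R * l\<^sup>2" using assms by (intro mult_right_mono) (auto simp: lp_ball_0)
  finally show ?thesis .
qed

text \<open>Interpolation: \<open>min (t\<^sup>2) (l\<^sup>2) \<le> l\<^bsup>2-p\<^esup> \<bar>t\<bar>\<^sup>p\<close>.\<close>

lemma sum_min_sq_lp_ball:
  assumes "0 < p" "p \<le> 1" "0 < R" "0 < l" and \<theta>: "\<theta> \<in> lp_ball d p R"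
  shows "(\<Sum>i<d. min ((\<theta> $ i)\<^sup>2) (l\<^sup>2)) \<le> l powr (2 - p) * R powr p"
proof -
  have sq: "t\<^sup>2 = t powr (2 - p) * t powr p" if "0 < t" for t :: real
    using that by (simp add: powr_add[symmetric])
  have "min (t\<^sup>2) (l\<^sup>2) \<le> l powr (2 - p) * \<bar>t\<bar> powr p" for t
  proof -
    consider "t = 0" | "0 < \<bar>t\<bar>" "\<bar>t\<bar> \<le> l" | "l < \<bar>t\<bar>" by linarith
    then show ?thesis
    proof cases
      case 2
      have "t\<^sup>2 = \<bar>t\<bar> powr (2 - p) * \<bar>t\<bar> powr p" using sq[OF 2(1)] by simp
      also have "\<dots> \<le> l powr (2 - p) * \<bar>t\<bar> powr p"
        using 2 assms by (intro mult_right_mono powr_mono2) auto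
      finally show ?thesis by simp
    next
      case 3
      have "l\<^sup>2 = l powr (2 - p) * l powr p" by (rule sq[OF \<open>0 < l\<close>])
      also have "\<dots> \<le> l powr (2 - p) * \<bar>t\<bar> powr p"
        using 3 assms by (intro mult_left_mono powr_mono2) auto
      finally show ?thesis by simp
    qed simp
  qed
  then have "(\<Sum>i<d. min ((\<theta> $ i)\<^sup>2) (l\<^sup>2)) \<le> l powr (2 - p) * (\<Sum>i<d. \<bar>\<theta> $ i\<bar> powr p)"
    unfolding sum_distrib_left by (intro sum_mono)
  also have "\<dots> \<le> l powr (2 - p) * R powr p"
    using \<theta> assms by (intro mult_left_mono) (auto simp: lp_ball_pos)
  finally show ?thesis .
qed

text \<open>Here \<open>\<delta>\<^sup>2 = \<omega>\<^sup>2 L / 4\<close> and \<open>l\<^sup>2 = 2 \<omega>\<^sup>2 L\<close> with \<open>L = ln (e d / s)\<close>. At this threshold \<open>exp (- L)\<close> is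
\<open>s / (e d)\<close>, which turns the \<open>d\<close> noise terms into \<open>s\<close> of them.\<close>

lemma minimax_risk_l0_bounds:
  assumes "0 < \<sigma>" "0 < B" "1 \<le> s" "s \<le> d" "d \<le> n"
  defines "r \<equiv> \<sigma>\<^sup>2 * B / real n * real s * ln (exp 1 * (real d / real s))"
  shows "ennreal (1 / 64 * r) \<le> minimax_risk n d 0 \<sigma> (real s) B"
    and "minimax_risk n d 0 \<sigma> (real s) B \<le> ennreal (20 * r)"
proof -
  define L where "L = ln (exp 1 * (real d / real s))"
  define \<omega> where "\<omega> = sqrt (\<sigma>\<^sup>2 * B / real n)"
  have n: "0 < real n" "1 \<le> n" using assms by auto
  have \<omega>: "0 < \<omega>" "\<omega>\<^sup>2 = \<sigma>\<^sup>2 * B / real n" using assms n by (auto simp: \<omega>_def)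
  have x: "1 \<le> real d / real s" using assms by simp
  have L: "1 \<le> L" using x ln_mult[of "exp 1" "real d / real s"] assms unfolding L_def by simp
  have r: "r = \<omega>\<^sup>2 * real s * L" by (simp add: r_def L_def \<omega>)
  have r0: "0 \<le> r" using L by (simp add: r)
  define \<delta> where "\<delta> = sqrt (\<omega>\<^sup>2 * L / 4)"
  have \<delta>2: "\<delta>\<^sup>2 = \<omega>\<^sup>2 * L / 4" using L by (simp add: \<delta>_def)
  have "ennreal (real s * \<delta>\<^sup>2 / 8) \<le> minimax_risk n d 0 \<sigma> (real s) B"
  proof (rule minimax_risk_ge_sparse[OF assms(1-5)])
    show "4 * \<delta>\<^sup>2 \<le> \<sigma>\<^sup>2 * B / real n * ln (exp 1 * (real d / real s))"
      unfolding \<omega>(2)[symmetric] L_def[symmetric] \<delta>2 by simp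
  qed (simp add: lp_ball_0)
  moreover have "1 / 64 * r \<le> real s * \<delta>\<^sup>2 / 8" using r0 by (simp add: r \<delta>2 mult_ac)
  ultimately show "ennreal (1 / 64 * r) \<le> minimax_risk n d 0 \<sigma> (real s) B"
    by (meson ennreal_leI order_trans)
  define l where "l = sqrt (2 * \<omega>\<^sup>2 * L)"
  have l: "0 < l" "l\<^sup>2 = 2 * \<omega>\<^sup>2 * L" using L \<omega>(1) by (auto simp: l_def)
  have l2: "2 * \<omega>\<^sup>2 \<le> l\<^sup>2" using L mult_left_mono[of 1 L "2 * \<omega>\<^sup>2"] by (simp add: l(2))
  have "minimax_risk n d 0 \<sigma> (real s) B
      \<le> ennreal (8 * (real s * l\<^sup>2) + 4 * (real d * \<omega>\<^sup>2 * exp (- (l\<^sup>2 / (2 * \<omega>\<^sup>2)))))"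
    by (rule minimax_risk_le_threshold[OF assms(1,2) n(2) \<omega> l(1) l2 sum_min_sq_lp_ball_0])
  also have "\<dots> \<le> ennreal (20 * r)"
  proof (rule ennreal_leI)
    have "exp (- (l\<^sup>2 / (2 * \<omega>\<^sup>2))) = exp (- L)" using \<omega>(1) by (simp add: l(2))
    also have "\<dots> = real s / (exp 1 * real d)"
      using assms by (simp add: L_def exp_minus field_simps)
    finally have "real d * \<omega>\<^sup>2 * exp (- (l\<^sup>2 / (2 * \<omega>\<^sup>2))) = \<omega>\<^sup>2 * real s * (1 / exp 1)"
      using assms by simp
    also have "\<dots> \<le> \<omega>\<^sup>2 * real s * L"
      using L order_trans[of "1 / exp (1::real)" 1 L] by (intro mult_left_mono) auto
    finally show "8 * (real s * l\<^sup>2) + 4 * (real d * \<omega>\<^sup>2 * exp (- (l\<^sup>2 / (2 * \<omega>\<^sup>2)))) \<le> 20 * r"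
      by (simp add: r l(2) mult_ac)
  qed
  finally show "minimax_risk n d 0 \<sigma> (real s) B \<le> ennreal (20 * r)" .
qed

text \<open>With \<open>q = \<tau>\<^sup>2 L\<close>, so that \<open>\<omega>\<^sup>2 L = R\<^sup>2 q\<close>, the effective sparsity is \<open>y = q\<^bsup>-p/2\<^esup>\<close>: this many entries
of size \<open>R sqrt q\<close> just fit into the ball. The lower bound on \<open>\<tau>\<close> says that \<open>d \<tau>\<^sup>p \<ge> 1\<close>, whence
\<open>L \<ge> 1\<close> and \<open>y \<le> \<tau>\<^bsup>-p\<^esup> \<le> d\<close>; the upper bound gives \<open>q \<le> 1\<close>, whence \<open>y \<ge> 1\<close>. Moreover \<open>y \<le> \<tau>\<^bsup>-p\<^esup>\<close>
makes \<open>ln (e d / s)\<close> at least \<open>L\<close>, so the sparse lower bound applies with \<open>s\<close> the integer part of \<open>y\<close>.\<close>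

lemma minimax_risk_lp_bounds:
  assumes "0 < \<sigma>" "0 < R" "0 < B" "1 \<le> d" "d \<le> n" "0 < p" "p \<le> 1"
    and \<tau>: "0 < \<tau>" "\<tau>\<^sup>2 = \<sigma>\<^sup>2 * B / (R\<^sup>2 * real n)"
    and lo: "real d powr (- 2 / p) \<le> \<tau>\<^sup>2" and hi: "\<tau>\<^sup>2 \<le> 1 / ln (exp 1 * real d)"
  defines "r \<equiv> R\<^sup>2 * (\<tau>\<^sup>2 * ln (exp 1 * real d * \<tau> powr p)) powr (1 - p / 2)"
  shows "ennreal (1 / 64 * r) \<le> minimax_risk n d p \<sigma> R B"
    and "minimax_risk n d p \<sigma> R B \<le> ennreal (20 * r)"
proof -
  define L where "L = ln (exp 1 * real d * \<tau> powr p)"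
  define q where "q = \<tau>\<^sup>2 * L"
  define \<omega> where "\<omega> = R * \<tau>"
  have n: "0 < real n" "1 \<le> n" using assms by auto
  have d: "0 < real d" using assms by simp
  have \<omega>: "0 < \<omega>" "\<omega>\<^sup>2 = \<sigma>\<^sup>2 * B / real n"
    using assms n by (auto simp: \<omega>_def power_mult_distrib)
  have \<tau>p: "(\<tau>\<^sup>2) powr a = \<tau> powr (2 * a)" for a
    using \<tau>(1) by (simp add: powr_powr flip: powr_numeral)
  have d\<tau>: "1 \<le> real d * \<tau> powr p"
  proof -
    have "(real d powr (- 2 / p)) powr (p / 2) \<le> (\<tau>\<^sup>2) powr (p / 2)"
      using lo assms by (intro powr_mono2) auto
    then have "real d powr (- 1) \<le> \<tau> powr p"
      using assms(6) d by (simp add: powr_powr \<tau>p)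
    then show ?thesis using d by (simp add: powr_minus field_simps)
  qed
  have L: "1 \<le> L"
  proof -
    have "exp 1 * 1 \<le> exp 1 * (real d * \<tau> powr p)" using d\<tau> by (intro mult_left_mono) auto
    then have "ln (exp 1) \<le> L" unfolding L_def by (intro ln_mono) (auto simp: mult.assoc)
    then show ?thesis by simp
  qed
  have q0: "0 < q" using L \<tau>(1) by (simp add: q_def)
  have \<tau>q: "\<tau>\<^sup>2 \<le> q" using L mult_left_mono[of 1 L "\<tau>\<^sup>2"] by (simp add: q_def)
  have q1: "q \<le> 1"
  proof -
    have led: "1 \<le> ln (exp 1 * real d)" using assms by (simp add: ln_mult)
    then have "1 / ln (exp 1 * real d) \<le> 1" by simp
    then have "\<tau>\<^sup>2 \<le> 1\<^sup>2" using hi by simp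
    then have "\<tau> \<le> 1" by (rule power2_le_imp_le) simp
    then have "\<tau> powr p \<le> 1" using \<tau> assms by (intro powr_le1) auto
    then have "exp 1 * real d * \<tau> powr p \<le> exp 1 * real d * 1" using d by (intro mult_left_mono) auto
    then have "L \<le> ln (exp 1 * real d)"
      unfolding L_def using d \<tau> by (intro ln_mono) auto
    then have "q \<le> \<tau>\<^sup>2 * ln (exp 1 * real d)" unfolding q_def by (intro mult_left_mono) auto
    also have "\<dots> \<le> 1" using hi led by (simp add: field_simps)
    finally show ?thesis .
  qed
  have r: "r = R\<^sup>2 * q powr (1 - p / 2)" by (simp add: r_def q_def L_def)

  define y where "y = q powr (- p / 2)"
  define s where "s = nat \<lfloor>y\<rfloor>"
  have y: "1 \<le> y" unfolding y_def
    using powr_mono2'[of "- p / 2" q 1] q0 q1 assms by simp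
  have y\<tau>: "y \<le> 1 / \<tau> powr p"
  proof -
    have "y \<le> (\<tau>\<^sup>2) powr (- p / 2)" unfolding y_def using \<tau>q \<tau>(1) assms(6) by (intro powr_mono2') auto
    also have "\<dots> = \<tau> powr (- p)" using \<tau>p[of "- p / 2"] by simp
    also have "\<dots> = 1 / \<tau> powr p" by (rule powr_minus_divide)
    finally show ?thesis .
  qed
  have s: "1 \<le> s" "real s \<le> y" "y \<le> 2 * real s"
  proof -
    have "real s = real_of_int \<lfloor>y\<rfloor>" using y by (simp add: s_def)
    then have "real s \<le> y" "y < real s + 1" by linarith+
    moreover from this y have "0 < real s" by linarith
    ultimately show "1 \<le> s" "real s \<le> y" "y \<le> 2 * real s" by auto
  qed
  have sd: "s \<le> d"
  proof -
    have "1 / \<tau> powr p \<le> real d" using d\<tau> \<tau> by (simp add: field_simps)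
    then have "real s \<le> real d" using s y\<tau> by linarith
    then show ?thesis by simp
  qed
  have Ls: "L \<le> ln (exp 1 * (real d / real s))"
    unfolding L_def
  proof (rule ln_mono)
    have "real s \<le> 1 / \<tau> powr p" using s(2) y\<tau> by linarith
    then have "real s * \<tau> powr p \<le> 1" using \<tau>(1) by (simp add: field_simps)
    then have "real d * \<tau> powr p \<le> real d / real s"
      using s(1) d by (simp add: field_simps)
    then show "exp 1 * real d * \<tau> powr p \<le> exp 1 * (real d / real s)"
      unfolding mult.assoc by (intro mult_left_mono) auto
  qed (use d \<tau> in auto)
  \<comment> \<open>Half of \<open>R sqrt q\<close>, which gives the factor \<open>4\<close> that the sparse lower bound asks for.\<close>
  define \<delta> where "\<delta> = R * sqrt q / 2"
  have \<delta>2: "\<delta>\<^sup>2 = R\<^sup>2 * q / 4" using q0 by (simp add: \<delta>_def power_mult_distrib power_divide)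
  have \<delta>0: "0 < \<delta>" using q0 assms by (simp add: \<delta>_def)
  have \<delta>p: "y * \<delta> powr p \<le> R powr p"
  proof -
    have "\<delta> powr p \<le> (R * sqrt q) powr p"
      using assms q0 by (intro powr_mono2) (auto simp: \<delta>_def)
    also have "\<dots> = R powr p * q powr (p / 2)"
      using assms q0 by (simp add: powr_mult powr_half_sqrt[symmetric] powr_powr)
    finally have "y * \<delta> powr p \<le> y * (R powr p * q powr (p / 2))" using y by simp
    also have "\<dots> = R powr p * (q powr (- p / 2) * q powr (p / 2))" by (simp add: y_def)
    also have "\<dots> = R powr p" using q0 by (simp flip: powr_add)
    finally show ?thesis .
  qed
  have "ennreal (real s * \<delta>\<^sup>2 / 8) \<le> minimax_risk n d p \<sigma> R B"
  proof (rule minimax_risk_ge_sparse[OF \<open>0 < \<sigma>\<close> \<open>0 < B\<close> s(1) sd \<open>d \<le> n\<close>])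
    have "4 * \<delta>\<^sup>2 = \<omega>\<^sup>2 * L" by (simp add: \<delta>2 q_def \<omega>_def power_mult_distrib)
    also have "\<dots> \<le> \<omega>\<^sup>2 * ln (exp 1 * (real d / real s))" using Ls by (intro mult_left_mono) auto
    finally show "4 * \<delta>\<^sup>2 \<le> \<sigma>\<^sup>2 * B / real n * ln (exp 1 * (real d / real s))" by (simp add: \<omega>)
  next
    fix \<theta> :: "real vec"
    assume \<theta>: "\<theta> \<in> carrier_vec d" "card {i. i < d \<and> \<theta> $ i \<noteq> 0} \<le> s" "\<And>i. i < d \<Longrightarrow> \<theta> $ i \<in> {0, \<delta>}"
    have "(\<Sum>i<d. \<bar>\<theta> $ i\<bar> powr p) = (\<Sum>i<d. if \<theta> $ i \<noteq> 0 then \<delta> powr p else 0)"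
      using \<theta>(3) \<delta>0 by (intro sum.cong) force+
    also have "\<dots> = real (card {i. i < d \<and> \<theta> $ i \<noteq> 0}) * \<delta> powr p"
      by (subst sum.inter_filter[symmetric]) (auto intro!: arg_cong[where f = card])
    also have "\<dots> \<le> y * \<delta> powr p" using \<theta>(2) s(2) by (intro mult_right_mono) auto
    finally show "\<theta> \<in> lp_ball d p R" using \<theta>(1) \<delta>p assms by (auto simp: lp_ball_pos)
  qed
  moreover have "1 / 64 * r \<le> real s * \<delta>\<^sup>2 / 8"
  proof -
    have "q powr (1 - p / 2) = y * q"
      using q0 powr_add[of q "- p / 2" 1] by (simp add: y_def)
    then have "1 / 64 * r = (y * (R\<^sup>2 * q)) / 64" by (simp add: r)
    also have "\<dots> \<le> (2 * real s * (R\<^sup>2 * q)) / 64"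
      using s(3) q0 by (intro divide_right_mono mult_right_mono) auto
    finally show ?thesis by (simp add: \<delta>2 mult_ac)
  qed
  ultimately show "ennreal (1 / 64 * r) \<le> minimax_risk n d p \<sigma> R B"
    by (meson ennreal_leI order_trans)

  define l where "l = sqrt (2 * \<omega>\<^sup>2 * L)"
  have l: "0 < l" "l\<^sup>2 = 2 * \<omega>\<^sup>2 * L" using L \<omega>(1) by (auto simp: l_def)
  have l2: "2 * \<omega>\<^sup>2 \<le> l\<^sup>2" using L mult_left_mono[of 1 L "2 * \<omega>\<^sup>2"] by (simp add: l(2))
  have "minimax_risk n d p \<sigma> R B
      \<le> ennreal (8 * (l powr (2 - p) * R powr p) + 4 * (real d * \<omega>\<^sup>2 * exp (- (l\<^sup>2 / (2 * \<omega>\<^sup>2)))))"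
    by (rule minimax_risk_le_threshold[OF assms(1,3) n(2) \<omega> l(1) l2
          sum_min_sq_lp_ball[OF assms(6,7,2) l(1)]])
  also have "\<dots> \<le> ennreal (20 * r)"
  proof (rule ennreal_leI)
    have "l powr (2 - p) = (l\<^sup>2) powr (1 - p / 2)"
      using l(1) by (simp add: powr_powr algebra_simps flip: powr_numeral)
    also have "l\<^sup>2 = R\<^sup>2 * (2 * q)" by (simp add: l(2) \<omega>_def q_def power_mult_distrib)
    also have "(R\<^sup>2 * (2 * q)) powr (1 - p / 2) = R powr (2 - p) * (2 powr (1 - p / 2) * q powr (1 - p / 2))"
      using assms(2) q0 by (simp add: powr_mult powr_powr algebra_simps flip: powr_numeral)
    finally have "l powr (2 - p) * R powr p = 2 powr (1 - p / 2) * r"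
      using assms(2) powr_add[of R "2 - p" p] by (simp add: r)
    also have "\<dots> \<le> 2 powr 1 * r"
      using assms(6) by (intro mult_right_mono powr_mono) (auto simp: r)
    finally have A: "l powr (2 - p) * R powr p \<le> 2 * r" by simp
    have "exp (- (l\<^sup>2 / (2 * \<omega>\<^sup>2))) = exp (- L)" using \<omega>(1) by (simp add: l(2))
    also have "\<dots> = 1 / (exp 1 * real d * \<tau> powr p)"
      using d \<tau> by (simp add: L_def exp_minus field_simps)
    finally have "real d * \<omega>\<^sup>2 * exp (- (l\<^sup>2 / (2 * \<omega>\<^sup>2))) = \<omega>\<^sup>2 / \<tau> powr p * (1 / exp 1)"
      using d by simp
    also have "\<dots> \<le> \<omega>\<^sup>2 / \<tau> powr p * 1"
      by (intro mult_left_mono) auto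
    also have "\<dots> = R\<^sup>2 * (\<tau>\<^sup>2) powr (1 - p / 2)"
      using \<tau>(1) by (simp add: \<tau>p \<omega>_def power_mult_distrib powr_diff algebra_simps)
    also have "\<dots> \<le> r" unfolding r using \<tau>q assms(6,7) by (intro mult_left_mono powr_mono2) auto
    finally show "8 * (l powr (2 - p) * R powr p) + 4 * (real d * \<omega>\<^sup>2 * exp (- (l\<^sup>2 / (2 * \<omega>\<^sup>2)))) \<le> 20 * r"
      using A by linarith
  qed
  finally show "minimax_risk n d p \<sigma> R B \<le> ennreal (20 * r)" .
qed

theorem theorem1:
  shows "\<exists>c\<^sub>l c\<^sub>u :: real. 0 < c\<^sub>l \<and> c\<^sub>l < c\<^sub>u \<and>
    (\<forall>(n::nat) (d::nat) (\<sigma>::real) (R::real) (B::real).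
      1 \<le> d \<and> d \<le> n \<and> 0 < \<sigma> \<and> 0 < R \<and> 0 < B \<longrightarrow>
      (let \<tau> = sqrt (\<sigma>\<^sup>2 * B / (R\<^sup>2 * real n)) in
        (\<forall>p::real. 0 < p \<and> p \<le> 1 \<and> \<tau>\<^sup>2 \<in> {real d powr (- 2 / p) .. 1 / ln (exp 1 * real d)} \<longrightarrow>
          ennreal (c\<^sub>l * (R\<^sup>2 * (\<tau>\<^sup>2 * ln (exp 1 * real d * \<tau> powr p)) powr (1 - p / 2)))
            \<le> minimax_risk n d p \<sigma> R B \<and>
          minimax_risk n d p \<sigma> R B
            \<le> ennreal (c\<^sub>u * (R\<^sup>2 * (\<tau>\<^sup>2 * ln (exp 1 * real d * \<tau> powr p)) powr (1 - p / 2)))) \<and>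
        (\<forall>s::nat. s \<in> {1..d} \<and> R = real s \<longrightarrow>
          ennreal (c\<^sub>l * (\<sigma>\<^sup>2 * B / real n * real s * ln (exp 1 * (real d / real s))))
            \<le> minimax_risk n d 0 \<sigma> (real s) B \<and>
          minimax_risk n d 0 \<sigma> (real s) B
            \<le> ennreal (c\<^sub>u * (\<sigma>\<^sup>2 * B / real n * real s * ln (exp 1 * (real d / real s)))))))"
proof (rule exI[of _ "1 / 64"], rule exI[of _ 20], intro conjI allI impI)
  fix n d :: nat and \<sigma> R B :: real
  assume *: "1 \<le> d \<and> d \<le> n \<and> 0 < \<sigma> \<and> 0 < R \<and> 0 < B"
  define \<tau> where "\<tau> = sqrt (\<sigma>\<^sup>2 * B / (R\<^sup>2 * real n))"
  have \<tau>: "0 < \<tau>" "\<tau>\<^sup>2 = \<sigma>\<^sup>2 * B / (R\<^sup>2 * real n)"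
    using * by (auto simp: \<tau>_def)
  show "let \<tau> = sqrt (\<sigma>\<^sup>2 * B / (R\<^sup>2 * real n)) in
        (\<forall>p::real. 0 < p \<and> p \<le> 1 \<and> \<tau>\<^sup>2 \<in> {real d powr (- 2 / p) .. 1 / ln (exp 1 * real d)} \<longrightarrow>
          ennreal (1 / 64 * (R\<^sup>2 * (\<tau>\<^sup>2 * ln (exp 1 * real d * \<tau> powr p)) powr (1 - p / 2)))
            \<le> minimax_risk n d p \<sigma> R B \<and>
          minimax_risk n d p \<sigma> R B
            \<le> ennreal (20 * (R\<^sup>2 * (\<tau>\<^sup>2 * ln (exp 1 * real d * \<tau> powr p)) powr (1 - p / 2)))) \<and>
        (\<forall>s::nat. s \<in> {1..d} \<and> R = real s \<longrightarrow>
          ennreal (1 / 64 * (\<sigma>\<^sup>2 * B / real n * real s * ln (exp 1 * (real d / real s))))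
            \<le> minimax_risk n d 0 \<sigma> (real s) B \<and>
          minimax_risk n d 0 \<sigma> (real s) B
            \<le> ennreal (20 * (\<sigma>\<^sup>2 * B / real n * real s * ln (exp 1 * (real d / real s)))))"
    unfolding Let_def \<tau>_def[symmetric]
    using * \<tau> by (intro conjI allI impI minimax_risk_lp_bounds minimax_risk_l0_bounds) auto
qed auto

end
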